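(* Let $f\in L^2([0,1)^d)$ and let data $Y^n=\delta^n f+\xi^n$, $n\in\mathbb M$, be given. Assume: (1) there are $\kappa>0$ and $M>0$ such that $|\mathscr R^n|\ge M n^\kappa$ for all sufficiently large $n\in\mathbb M$; (2) there is $\beta>0$ such that for each $n\in\mathbb M$, all real numbers $\mu_s$, $s\in S^n$, and each $c\ge 0$, $$\mathbb P\Big(\Big|\sum_{s\in S^n}\mu_s\xi_s^n\Big|\ge c\Big)\le 2\exp\Big(-\frac{c^2}{\beta\sum_{s\in S^n}\mu_s^2}\Big);$$ (3) $(\gamma_n)$ is a positive sequence with $\gamma_n\to 0$ and, for all sufficiently large $n$, $\gamma_n>\beta D\,\frac{\kappa+1}{\kappa}\cdot\frac{\ln|\mathscr R^n|}{|S^n|}$, where $D$ is an upper bound for the dimensions of the spaces $\mathscr G^n_P$, $P\in\mathscr R^n$, $n\in\mathbb M$; (4) there are real numbers $\alpha,C>0$, $\varrho\ge 0$ and a sequence $(F_n)$ of positive reals with $F_n\to\infty$ such that for all $n\in\mathbb M$ and all $k\in\mathbb N$ there is $(\mathscr Q,h)\in\mathfrak S^n$ with $|\mathscr Q|\le k$ and $$\|\iota^n h-f\|\le C\Big(\frac{k^\varrho}{F_n}+\frac1{k^\alpha}\Big).$$ For each $n\in\mathbb M$ let $(\hat{\mathscr P}^n,\hat f^n)$ be a minimiser over $(\mathscr Q,h)\in\mathfrak S^n$ of $\gamma_n|\mathscr Q|+\|h-Y^n\|^2/|S^n|$. Then for almost all $\omega\in\Omega$, as $n\to\infty$ along $\mathbb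 M$, $$\|\iota^n\hat f^n(\omega)-f\|^2=O\Big(\gamma_n^{\frac{2\alpha}{2\alpha+1}}\Big)+O\Big(F_n^{-\frac{2\alpha}{\alpha+\varrho}}\Big).$$
   Context: $\mathbb M$ is an infinite subset of $\mathbb N=\{1,2,\dots\}$; $d\in\mathbb N$; $S^n=\{1,\dots,n\}^d$. For $s=(i_1,\dots,i_d)\in S^n$ let $I_s=I^n_s=\prod_{j=1}^d[(i_j-1)/n,i_j/n)$. Define $\delta^n:L^2([0,1)^d)\to\mathbb R^{S^n}$ by $(\delta^n g)_s=n^d\int_{I_s}g(u)\,du$ and $\iota^n:\mathbb R^{S^n}\to L^2([0,1)^d)$ by $\iota^n z=\sum_{s\in S^n}z_s\mathbf 1_{I_s}$. The norm of elements of $\mathbb R^{S^n}$ is Euclidean; the norm of functions on $[0,1)^d$ is that of $L^2$. The noise variables $\xi^n=(\xi^n_s)_{s\in S^n}$, $n\in\mathbb M$, are real random variables on a common probability space $(\Omega,\mathscr F,\mathbb P)$. Projective segmentation classes: fix a finite-dimensional linear subspace $\mathscr G\subset L^2([0,1)^d)$. For $P\subset S^n$ let $\mathscr G^n_P=\{\mathbf 1_P\cdot \delta^n g: g\in\mathscr G\}\subset\mathbb R^{S^n}$. For each $n\in\mathbb M$ a set $\mathscr R^n\subset 2^{S^n}$ of admissible fragments and a (nonempty) set $\mathfrak P^n$ of partitions of $S^n$ all of whose elements belong to $\mathscr R^n$ are given. For $\mathscr P\in\mathfrak P^n$ let $\mathscr G_{\mathscr P}=\mathrm{span}\{\mathscr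 G^n_P:P\in\mathscr P\}$. Then $\mathfrak S^n=\{(\mathscr P,h):\mathscr P\in\mathfrak P^n,\ h\in\mathscr G_{\mathscr P}\}$; $|\mathscr P|$ is the number of elements of $\mathscr P$. *)

theory Defs
  imports "HOL-Probability.Probability" "HOL-Library.Landau_Symbols"
    "HOL-Library.Function_Algebras" "HOL-Library.Disjoint_Sets"
begin

text \<open>
  Conventions. The dimension \<open>d\<close> is the cardinality of the index type \<open>'d\<close>.
  An element of \<open>L\<^sup>2([0,1)\<^sup>d)\<close> is represented by a function on \<open>real ^ 'd\<close> that is Lebesgue
  measurable and square integrable on the cube (its values outside the cube play no role);
  equality of elements is equality almost everywhere on the cube. A linear subspace is given by
  a linear space of representatives, which need not be closed under changes on null sets; hence
  finite dimensionality is required only up to almost everywhere equality. A vector indexed by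
  \<open>grid n\<close> is represented by a function on \<open>nat ^ 'd\<close> that is only evaluated on \<open>grid n\<close>;
  the spaces of such vectors below consist of functions vanishing outside \<open>grid n\<close>.
\<close>

global_interpretation fun_space: vector_space "\<lambda>(c::real) (f::'a \<Rightarrow> real) x. c * f x"
  by unfold_locales (auto simp: fun_eq_iff algebra_simps)

definition cube :: "(real ^ 'd) set" where
  "cube = {x. \<forall>j. 0 \<le> x $ j \<and> x $ j < 1}"

definition grid :: "nat \<Rightarrow> (nat ^ 'd) set" where
  "grid n = {s. \<forall>j. s $ j \<in> {1..n}}"

definition cell :: "nat \<Rightarrow> nat ^ 'd \<Rightarrow> (real ^ 'd) set" where
  "cell n s = {x. \<forall>j. (real (s $ j) - 1) / real n \<le> x $ j \<and> x $ j < real (s $ j) / real n}"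

definition L2 :: "(real ^ 'd \<Rightarrow> real) set" where
  "L2 = {g. g \<in> borel_measurable (lebesgue_on cube) \<and>
            integrable (lebesgue_on cube) (\<lambda>x. (g x)\<^sup>2)}"

definition L2_norm :: "(real ^ 'd \<Rightarrow> real) \<Rightarrow> real" where
  "L2_norm g = sqrt (\<integral>x. (g x)\<^sup>2 \<partial>lebesgue_on cube)"

definition finite_dim_L2_subspace :: "(real ^ 'd \<Rightarrow> real) set \<Rightarrow> bool" where
  "finite_dim_L2_subspace G \<longleftrightarrow>
     G \<subseteq> L2 \<and> fun_space.subspace G \<and>
     (\<exists>B. finite B \<and> B \<subseteq> G \<and>
        (\<forall>g\<in>G. \<exists>b\<in>fun_space.span B. AE x in lebesgue_on cube. g x = b x))"

definition discretise :: "nat \<Rightarrow> (real ^ 'd \<Rightarrow> real) \<Rightarrow> nat ^ 'd \<Rightarrow> real" where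
  "discretise n g s =
     (if s \<in> grid n
      then real n ^ CARD('d) * (\<integral>u. g u \<partial>lebesgue_on (cell n s))
      else 0)"

definition step_fun :: "nat \<Rightarrow> (nat ^ 'd \<Rightarrow> real) \<Rightarrow> real ^ 'd \<Rightarrow> real" where
  "step_fun n z x = (\<Sum>s\<in>grid n. z s * indicator (cell n s) x)"

definition fragment_space ::
  "(real ^ 'd \<Rightarrow> real) set \<Rightarrow> nat \<Rightarrow> (nat ^ 'd) set \<Rightarrow> (nat ^ 'd \<Rightarrow> real) set" where
  "fragment_space G n P = {\<lambda>s. indicator P s * discretise n g s |g. g \<in> G}"

definition partition_space ::
  "(real ^ 'd \<Rightarrow> real) set \<Rightarrow> nat \<Rightarrow> (nat ^ 'd) set set \<Rightarrow> (nat ^ 'd \<Rightarrow> real) set" where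
  "partition_space G n Q = fun_space.span (\<Union>P\<in>Q. fragment_space G n P)"

definition segmentations ::
  "(real ^ 'd \<Rightarrow> real) set \<Rightarrow> (nat \<Rightarrow> (nat ^ 'd) set set set) \<Rightarrow> nat
    \<Rightarrow> ((nat ^ 'd) set set \<times> (nat ^ 'd \<Rightarrow> real)) set" where
  "segmentations G \<PP> n = {(Q, h). Q \<in> \<PP> n \<and> h \<in> partition_space G n Q}"

definition penalised_loss ::
  "nat \<Rightarrow> real \<Rightarrow> (nat ^ 'd \<Rightarrow> real) \<Rightarrow> (nat ^ 'd) set set \<times> (nat ^ 'd \<Rightarrow> real) \<Rightarrow> real" where
  "penalised_loss n c y = (\<lambda>(Q, h).
     c * real (card Q) +
     (L2_set (\<lambda>s. h s - y s) (grid n))\<^sup>2 / real (card (grid n :: (nat ^ 'd) set)))"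

end

theory Submission
  imports Defs
begin

text \<open>
  Fix \<open>n\<close> and a deterministic competitor \<open>(Q, h)\<close>, and let \<open>N\<close> be the number of cells and \<open>g\<close> the
  discretisation of \<open>f\<close>. With \<open>x\<close> and \<open>b\<close> the Euclidean distances of the estimator and of \<open>h\<close>
  to \<open>g\<close>, minimality gives
  \<open>x\<^sup>2 \<le> \<gamma> N (|Q| - |P|) + b\<^sup>2 + 2 (x + b) W\<close>, where \<open>W\<close> is the length of the projection of the
  noise onto the span of the space of the estimated partition \<open>P\<close> and of \<open>h\<close>. Since the penalty
  level carries no slack, \<open>W\<^sup>2\<close> must be strictly dominated by the penalty:
  \<open>W\<^sup>2 \<le> \<theta> \<gamma> N (|P| + K)\<close> with \<open>\<theta> < 1\<close>, almost surely for all large \<open>n\<close>. To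
  obtain it, count one exceptional event per partition rather than one per fragment: at most
  \<open>|R|\<^sup>m\<close> partitions have \<open>m\<close> fragments, so the union bound uses up only \<open>1\<close> of the factor
  \<open>1 + 1 / \<kappa>\<close> in the penalty, and summability over \<open>n\<close> is paid for by the constant \<open>K\<close>. Completing the square yields
  \<open>x\<^sup>2 = O(\<gamma> N |Q| + b\<^sup>2)\<close>; as \<open>f - \<iota> g\<close> is orthogonal to step functions, this carries over to
  \<open>L\<^sup>2\<close>, and it remains to optimise the number of fragments of \<open>Q\<close>.
\<close>

subsection \<open>Sums of squares of sub-Gaussian variables\<close>

text \<open>The correction term makes the induction close: passing from \<open>b\<close> to
  \<open>b + 1\<close> adds two terms \<open>exp (- (b + 1))\<close>, and
  \<open>exp 1 \<ge> 2\<close> shows that the right-hand side grows by at least as much.\<close>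

lemma sum_exp_neg_abs_le: "(\<Sum>z\<in>{-int b..int b}. exp (- \<bar>real_of_int z\<bar>)) \<le> 4 - 2 * exp (- real b)"
proof (induction b)
  case 0 then show ?case by simp
next
  case (Suc b)
  have *: "{-int (Suc b)..int (Suc b)} = insert (int (Suc b)) (insert (- int (Suc b)) {-int b..int b})"
    by auto
  have "exp 1 * exp (- real (Suc b)) = exp (- real b)"
    by (simp flip: exp_add)
  moreover have "2 * exp (- real (Suc b)) \<le> exp 1 * exp (- real (Suc b))"
    using exp_ge_add_one_self[of 1] by (intro mult_right_mono) auto
  moreover have "(\<Sum>z\<in>{-int (Suc b)..int (Suc b)}. exp (- \<bar>real_of_int z\<bar>))
      = 2 * exp (- real (Suc b)) + (\<Sum>z\<in>{-int b..int b}. exp (- \<bar>real_of_int z\<bar>))"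
    unfolding * by (simp add: add.commute)
  ultimately show ?case
    using Suc by linarith
qed

text \<open>If the vector of the \<open>X j\<close> is long, it has a large inner product with some
  vector of a finite net, and \<open>tail\<close> controls each such inner product. A share
  \<epsilon> of the exponent pays for the sum over the net. What remains decays at a rate
  arbitrarily close to \<open>1 / \<beta>\<close>, with a prefactor merely exponential in
  \<open>p\<close>. Independence of the \<open>X j\<close> is not assumed.\<close>

lemma (in prob_space) subgaussian_sum_squares_tail:
  fixes X :: "nat \<Rightarrow> 'a \<Rightarrow> real" and p :: nat and \<beta> \<epsilon> y :: real
  assumes X: "\<And>j. j < p \<Longrightarrow> X j \<in> borel_measurable M"
    and \<beta>: "\<beta> > 0" and \<epsilon>: "0 < \<epsilon>" "\<epsilon> < 1" and y: "y \<ge> 0"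
    and tail: "\<And>w c. c \<ge> 0 \<Longrightarrow> prob {\<omega> \<in> space M. \<bar>\<Sum>j<p. w j * X j \<omega>\<bar> \<ge> c}
                 \<le> 2 * exp (- (c\<^sup>2 / (\<beta> * (\<Sum>j<p. (w j)\<^sup>2))))"
  shows "prob {\<omega> \<in> space M. (\<Sum>j<p. (X j \<omega>)\<^sup>2) \<ge> y}
           \<le> 2 * (4 * exp (1 / \<epsilon>)) ^ p * exp (- ((1 - \<epsilon>) * y / \<beta>))"
proof -
  \<comment> \<open>This scale gives \<open>\<epsilon> * r / \<beta> = 1\<close>, so that the share
    \<epsilon> of the exponent of a net point \<open>z\<close> is exactly the product of the
    \<open>exp (- \<bar>z j\<bar>)\<close>.\<close>
  define r where "r = \<beta> / \<epsilon>"
  have r: "r > 0" using \<beta> \<epsilon> by (simp add: r_def)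
  define b where "b = nat \<lfloor>y / r\<rfloor>"
  define Z where "Z = ({..<p} \<rightarrow>\<^sub>E {-int b..int b})"
  have finZ: "finite Z" unfolding Z_def by (intro finite_PiE) auto
  \<comment> \<open>The integer \<open>z j\<close> records the sign of a coordinate and its square in units of \<open>r\<close>; rounding
    the squares makes the test \<open>\<Sum> w X \<ge> \<Sum> w\<^sup>2\<close> lose at most \<open>r\<close> per coordinate.\<close>
  define w :: "(nat \<Rightarrow> int) \<Rightarrow> nat \<Rightarrow> real" where "w z j = sgn (z j) * sqrt (r * \<bar>z j\<bar>)" for z j
  have w2: "(w z j)\<^sup>2 = r * \<bar>z j\<bar>" for z j
    using r by (auto simp: w_def power_mult_distrib sgn_if)
  define q where "q z = (\<Sum>j<p. r * \<bar>real_of_int (z j)\<bar>)" for z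
  have q0: "q z \<ge> 0" for z unfolding q_def using r by (intro sum_nonneg) auto
  define T where "T = {z \<in> Z. y - r * p \<le> q z}"
  have finT: "finite T" using finZ by (simp add: T_def)
  define E where "E z = {\<omega> \<in> space M. \<bar>\<Sum>j<p. w z j * X j \<omega>\<bar> \<ge> q z}" for z
  have E_meas: "E z \<in> events" for z
    unfolding E_def using X by measurable
  have PE: "prob (E z) \<le> 2 * exp (- q z / \<beta>)" for z
  proof -
    \<comment> \<open>The squared norm of the weights is \<open>q z\<close> itself, so the threshold
      \<open>q z\<close> makes the quotient collapse. For \<open>q z = 0\<close> both sides are
      \<open>0\<close> by the convention for division.\<close>
    have "(q z)\<^sup>2 / (\<beta> * (\<Sum>j<p. (w z j)\<^sup>2)) = q z / \<beta>"
      unfolding w2 q_def by (simp add: power2_eq_square)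
    then show ?thesis using tail[OF q0[of z], of "w z"] by (simp add: E_def)
  qed
  have cover: "{\<omega> \<in> space M. (\<Sum>j<p. (X j \<omega>)\<^sup>2) \<ge> y} \<subseteq> (\<Union>z\<in>T. E z)"
  proof safe
    fix \<omega> assume \<omega>: "\<omega> \<in> space M" and ge: "y \<le> (\<Sum>j<p. (X j \<omega>)\<^sup>2)"
    define S where "S = (\<Sum>j<p. (X j \<omega>)\<^sup>2)"
    \<comment> \<open>Scaling the observed vector down to norm \<open>sqrt y\<close> keeps the net finite.\<close>
    define t where "t = (if S = 0 then 0 else sqrt (y / S))"
    have S0: "S \<ge> 0" unfolding S_def by (intro sum_nonneg) auto
    have t: "0 \<le> t" "t \<le> 1" using S0 y ge by (auto simp: t_def S_def[symmetric])
    have tS: "t\<^sup>2 * S = y" using S0 y ge by (auto simp: t_def S_def[symmetric])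
    define v where "v j = t * X j \<omega>" for j
    have v2: "(\<Sum>j<p. (v j)\<^sup>2) = y"
      using tS by (simp add: v_def power_mult_distrib S_def sum_distrib_left)
    have v2le: "(v j)\<^sup>2 \<le> y" if "j < p" for j
      unfolding v2[symmetric] using that by (intro member_le_sum) auto
    define z where "z = (\<lambda>j\<in>{..<p}. (if v j < 0 then -1 else 1) * \<lfloor>(v j)\<^sup>2 / r\<rfloor>)"
    have az: "\<bar>z j\<bar> = \<lfloor>(v j)\<^sup>2 / r\<rfloor>" if "j < p" for j
      using that r by (auto simp: z_def)
    have zZ: "z \<in> Z"
    proof -
      have "z j \<in> {-int b..int b}" if "j < p" for j
      proof -
        have "\<bar>z j\<bar> \<le> \<lfloor>y / r\<rfloor>"
          unfolding az[OF that] using v2le[OF that] r by (intro floor_mono divide_right_mono) auto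
        moreover have "\<lfloor>y / r\<rfloor> \<ge> 0" using y r by simp
        ultimately show ?thesis unfolding b_def by auto
      qed
      then show ?thesis unfolding Z_def by (auto simp: z_def)
    qed
    have zle: "r * \<bar>real_of_int (z j)\<bar> \<le> (v j)\<^sup>2" and zge: "(v j)\<^sup>2 - r \<le> r * \<bar>real_of_int (z j)\<bar>" if "j < p" for j
    proof -
      have *: "\<bar>real_of_int (z j)\<bar> = of_int \<lfloor>(v j)\<^sup>2 / r\<rfloor>"
        using az[OF that] by (metis of_int_abs)
      have "r * of_int \<lfloor>(v j)\<^sup>2 / r\<rfloor> \<le> r * ((v j)\<^sup>2 / r)"
        "r * ((v j)\<^sup>2 / r - 1) \<le> r * of_int \<lfloor>(v j)\<^sup>2 / r\<rfloor>"
        using r by (intro mult_left_mono; linarith)+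
      then show "r * \<bar>real_of_int (z j)\<bar> \<le> (v j)\<^sup>2" "(v j)\<^sup>2 - r \<le> r * \<bar>real_of_int (z j)\<bar>"
        unfolding * using r by (simp_all add: right_diff_distrib)
    qed
    have "y - r * p = (\<Sum>j<p. (v j)\<^sup>2 - r)"
      by (simp add: sum_subtractf v2)
    also have "\<dots> \<le> q z" unfolding q_def using zge by (intro sum_mono) auto
    finally have zT: "z \<in> T" using zZ by (simp add: T_def)
    have "r * \<bar>real_of_int (z j)\<bar> \<le> w z j * X j \<omega>" if j: "j < p" for j
    proof -
      have "sqrt (r * \<bar>real_of_int (z j)\<bar>) \<le> \<bar>v j\<bar>"
        using zle[OF j] by (metis real_sqrt_abs real_sqrt_le_iff)
      also have "\<dots> \<le> \<bar>X j \<omega>\<bar>" unfolding v_def abs_mult using t by (simp add: mult_left_le_one_le)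
      finally have le: "sqrt (r * \<bar>real_of_int (z j)\<bar>) \<le> \<bar>X j \<omega>\<bar>" .
      \<comment> \<open>A nonzero \<open>z j\<close> forces \<open>v j \<noteq> 0\<close>, hence
        \<open>t > 0\<close>, and \<open>X j \<omega>\<close> has the sign of \<open>v j\<close>,
        which is the one stored in \<open>z j\<close>.\<close>
      have sg: "w z j * X j \<omega> = sqrt (r * \<bar>real_of_int (z j)\<bar>) * \<bar>X j \<omega>\<bar>"
      proof (cases "z j = 0")
        case False
        then have nz: "\<lfloor>(v j)\<^sup>2 / r\<rfloor> \<noteq> 0" using az[OF j] by auto
        have "(v j)\<^sup>2 / r \<ge> 0" using r by simp
        with nz have fl: "\<lfloor>(v j)\<^sup>2 / r\<rfloor> > 0" by linarith
        then have "v j \<noteq> 0" by auto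
        then have "v j < 0 \<longleftrightarrow> X j \<omega> < 0" "X j \<omega> \<noteq> 0" using t unfolding v_def
          by (auto simp: mult_less_0_iff)
        then show ?thesis using j fl by (auto simp: w_def z_def sgn_if abs_mult)
      qed (simp add: w_def)
      have "r * \<bar>real_of_int (z j)\<bar> = sqrt (r * \<bar>real_of_int (z j)\<bar>) * sqrt (r * \<bar>real_of_int (z j)\<bar>)"
        using r by simp
      also have "\<dots> \<le> sqrt (r * \<bar>real_of_int (z j)\<bar>) * \<bar>X j \<omega>\<bar>"
        using le r by (intro mult_left_mono) auto
      finally show ?thesis unfolding sg .
    qed
    then have "q z \<le> (\<Sum>j<p. w z j * X j \<omega>)" unfolding q_def by (intro sum_mono) auto
    then have "\<omega> \<in> E z" using \<omega> by (auto simp: E_def)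
    then show "\<omega> \<in> (\<Union>z\<in>T. E z)" using zT by blast
  qed
  have "prob {\<omega> \<in> space M. (\<Sum>j<p. (X j \<omega>)\<^sup>2) \<ge> y} \<le> prob (\<Union>z\<in>T. E z)"
    using cover E_meas finT by (intro finite_measure_mono) auto
  also have "\<dots> \<le> (\<Sum>z\<in>T. prob (E z))"
    using E_meas finT by (intro finite_measure_subadditive_finite) auto
  \<comment> \<open>The exponent is split: the share \<open>1 - \<epsilon>\<close> is bounded
    through membership in \<open>T\<close>, the share \<epsilon> becomes a product over the
    coordinates.\<close>
  also have "\<dots> \<le> (\<Sum>z\<in>T. 2 * exp (- ((1 - \<epsilon>) * (y - r * p) / \<beta>)) * (\<Prod>j<p. exp (- \<bar>real_of_int (z j)\<bar>)))"
  proof (intro sum_mono)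
    fix z assume z: "z \<in> T"
    have er: "\<epsilon> * r / \<beta> = 1" using \<epsilon> \<beta> by (simp add: r_def)
    have "(\<Prod>j<p. exp (- \<bar>real_of_int (z j)\<bar>)) = exp (- (\<epsilon> * q z / \<beta>))"
    proof -
      have "\<epsilon> * q z / \<beta> = (\<Sum>j<p. (\<epsilon> * r / \<beta>) * \<bar>real_of_int (z j)\<bar>)"
        unfolding q_def by (simp add: sum_distrib_left sum_divide_distrib field_simps)
      then show ?thesis unfolding er by (simp add: exp_sum[symmetric] sum_negf)
    qed
    moreover have "(1 - \<epsilon>) * (y - r * p) / \<beta> \<le> (1 - \<epsilon>) * q z / \<beta>"
      using z \<epsilon> \<beta> by (intro divide_right_mono mult_left_mono) (auto simp: T_def)
    moreover have "- q z / \<beta> = - ((1 - \<epsilon>) * q z / \<beta>) - \<epsilon> * q z / \<beta>"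
      by (simp add: left_diff_distrib diff_divide_distrib)
    ultimately have "exp (- q z / \<beta>)
        \<le> exp (- ((1 - \<epsilon>) * (y - r * p) / \<beta>)) * (\<Prod>j<p. exp (- \<bar>real_of_int (z j)\<bar>))"
      by (simp flip: exp_add)
    then show "prob (E z) \<le> 2 * exp (- ((1 - \<epsilon>) * (y - r * p) / \<beta>)) * (\<Prod>j<p. exp (- \<bar>real_of_int (z j)\<bar>))"
      using PE[of z] by linarith
  qed
  \<comment> \<open>Enlarging \<open>T\<close> to the full product set \<open>Z\<close> lets the sum
    of products factorise into a \<open>p\<close>-th power.\<close>
  also have "\<dots> \<le> (\<Sum>z\<in>Z. 2 * exp (- ((1 - \<epsilon>) * (y - r * p) / \<beta>)) * (\<Prod>j<p. exp (- \<bar>real_of_int (z j)\<bar>)))"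
    using finZ by (intro sum_mono2) (auto simp: T_def intro!: mult_nonneg_nonneg prod_nonneg)
  also have "\<dots> = 2 * exp (- ((1 - \<epsilon>) * (y - r * p) / \<beta>)) * (\<Sum>i\<in>{-int b..int b}. exp (- \<bar>real_of_int i\<bar>)) ^ p"
    unfolding Z_def by (subst sum_distrib_left[symmetric], subst prod_sum_PiE[symmetric]) auto
  also have "\<dots> \<le> 2 * exp (- ((1 - \<epsilon>) * (y - r * p) / \<beta>)) * 4 ^ p"
  proof -
    have "(\<Sum>i\<in>{-int b..int b}. exp (- \<bar>real_of_int i\<bar>)) \<le> 4"
      using sum_exp_neg_abs_le[of b] exp_gt_zero[of "- real b"] by linarith
    then show ?thesis by (intro mult_left_mono power_mono sum_nonneg) auto
  qed
  \<comment> \<open>The rounding loss \<open>r * p\<close> costs at most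
    \<open>p / \<epsilon>\<close> in the exponent, which is the origin of the factor
    \<open>exp (1 / \<epsilon>) ^ p\<close>.\<close>
  also have "exp (- ((1 - \<epsilon>) * (y - r * p) / \<beta>)) \<le> exp (- ((1 - \<epsilon>) * y / \<beta>)) * exp (1 / \<epsilon>) ^ p"
  proof -
    have "(1 - \<epsilon>) * (r * p) / \<beta> = (1 - \<epsilon>) / \<epsilon> * p" using \<beta> by (simp add: r_def)
    also have "\<dots> \<le> 1 / \<epsilon> * p" using \<epsilon> by (intro mult_right_mono divide_right_mono) auto
    finally have "- ((1 - \<epsilon>) * (y - r * p) / \<beta>) \<le> - ((1 - \<epsilon>) * y / \<beta>) + p * (1 / \<epsilon>)"
      by (simp add: algebra_simps diff_divide_distrib add_divide_distrib)
    then show ?thesis unfolding exp_of_nat_mult[symmetric] by (simp flip: exp_add)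
  qed
  finally show ?thesis by (simp add: power_mult_distrib mult_ac)
qed

subsection \<open>Orthonormal frames and fragment spaces\<close>

lemma orthonormal_combination_inner:
  fixes e :: "nat \<Rightarrow> 'a \<Rightarrow> real"
  assumes orth: "\<And>i j. i < p \<Longrightarrow> j < p \<Longrightarrow> (\<Sum>s\<in>S. e i s * e j s) = of_bool (i = j)"
    and i: "i < p"
  shows "(\<Sum>s\<in>S. (\<Sum>j<p. c j * e j s) * e i s) = c i"
proof -
  have "(\<Sum>s\<in>S. (\<Sum>j<p. c j * e j s) * e i s) = (\<Sum>j<p. \<Sum>s\<in>S. c j * (e j s * e i s))"
    by (subst sum.swap) (simp add: sum_distrib_right mult.assoc)
  also have "\<dots> = (\<Sum>j<p. c j * (\<Sum>s\<in>S. e j s * e i s))"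
    by (simp add: sum_distrib_left)
  also have "\<dots> = (\<Sum>j<p. if j = i then c j else 0)"
    using i by (intro sum.cong) (auto simp: orth)
  also have "\<dots> = c i" using i by simp
  finally show ?thesis .
qed

lemma orthonormal_combination_norm:
  fixes e :: "nat \<Rightarrow> 'a \<Rightarrow> real"
  assumes orth: "\<And>i j. i < p \<Longrightarrow> j < p \<Longrightarrow> (\<Sum>s\<in>S. e i s * e j s) = of_bool (i = j)"
  shows "(\<Sum>s\<in>S. (\<Sum>j<p. c j * e j s)\<^sup>2) = (\<Sum>j<p. (c j)\<^sup>2)"
proof -
  have "(\<Sum>s\<in>S. (\<Sum>j<p. c j * e j s)\<^sup>2) = (\<Sum>s\<in>S. \<Sum>i<p. c i * ((\<Sum>j<p. c j * e j s) * e i s))"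
    by (intro sum.cong refl) (simp add: power2_eq_square sum_distrib_left mult_ac)
  also have "\<dots> = (\<Sum>i<p. c i * (\<Sum>s\<in>S. (\<Sum>j<p. c j * e j s) * e i s))"
    by (subst sum.swap) (simp add: sum_distrib_left)
  also have "\<dots> = (\<Sum>i<p. (c i)\<^sup>2)"
    by (intro sum.cong refl) (simp add: orthonormal_combination_inner[OF orth] power2_eq_square)
  finally show ?thesis .
qed

text \<open>One vector is added at a time. Only values on \<open>S\<close> count: if the residual of
  the new vector vanishes there, the frame stays as it is, which is why \<open>p\<close> may be
  smaller than \<open>card B\<close>; otherwise the normalised residual is appended.\<close>

lemma gram_schmidt:
  fixes B :: "('a \<Rightarrow> real) set"
  assumes "finite B" "finite S"
  shows "\<exists>p e. p \<le> card B
    \<and> (\<forall>i<p. \<forall>j<p. (\<Sum>s\<in>S. e i s * e j s) = of_bool (i = j))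
    \<and> (\<forall>b\<in>B. \<exists>c. \<forall>s\<in>S. b s = (\<Sum>j<p. c j * e j s))"
  using assms(1)
proof (induction B rule: finite_induct)
  case empty
  then show ?case by auto
next
  case (insert b B)
  then obtain p and e :: "nat \<Rightarrow> 'a \<Rightarrow> real" where p: "p \<le> card B"
    and orth: "\<And>i j. i < p \<Longrightarrow> j < p \<Longrightarrow> (\<Sum>s\<in>S. e i s * e j s) = of_bool (i = j)"
    and comb: "\<And>b. b \<in> B \<Longrightarrow> \<exists>c. \<forall>s\<in>S. b s = (\<Sum>j<p. c j * e j s)"
    by blast
  define a where "a j = (\<Sum>s\<in>S. b s * e j s)" for j
  define u where "u s = b s - (\<Sum>j<p. a j * e j s)" for s
  define N where "N = (\<Sum>s\<in>S. (u s)\<^sup>2)"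
  have N0: "N \<ge> 0" unfolding N_def by (intro sum_nonneg) auto
  have ue: "(\<Sum>s\<in>S. u s * e i s) = 0" if "i < p" for i
    using orthonormal_combination_inner[where S = S and c = a, OF orth that]
    by (simp add: u_def a_def left_diff_distrib sum_subtractf)
  show ?case
  proof (cases "N = 0")
    case True
    then have "b s = (\<Sum>j<p. a j * e j s)" if "s \<in> S" for s
      using that \<open>finite S\<close> unfolding N_def by (subst (asm) sum_nonneg_eq_0_iff) (auto simp: u_def)
    then show ?thesis
      using comb orth p insert.hyps by (intro exI[of _ p] exI[of _ e]) (auto intro!: exI[of _ a])
  next
    case False
    with N0 have N: "N > 0" by simp
    define e' where "e' = e(p := (\<lambda>s. u s / sqrt N))"
    have e'p: "e' p = (\<lambda>s. u s / sqrt N)" and e': "\<And>j. j < p \<Longrightarrow> e' j = e j"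
      by (auto simp: e'_def)
    have cross: "(\<Sum>s\<in>S. e' p s * e i s) = 0" if "i < p" for i
      using ue[OF that] unfolding e'p by (simp add: sum_divide_distrib[symmetric])
    have self: "(\<Sum>s\<in>S. e' p s * e' p s) = 1"
      using N unfolding e'p by (simp add: sum_divide_distrib[symmetric] N_def power2_eq_square)
    have "(\<Sum>s\<in>S. e' i s * e' j s) = of_bool (i = j)" if "i < Suc p" "j < Suc p" for i j
      using that orth cross self
      by (cases "i = p"; cases "j = p") (auto simp: e' less_Suc_eq mult.commute)
    moreover have "\<exists>c. \<forall>s\<in>S. x s = (\<Sum>j<Suc p. c j * e' j s)" if "x \<in> insert b B" for x
    proof (cases "x = b")
      case True
      have "x s = (\<Sum>j<Suc p. (a(p := sqrt N)) j * e' j s)" for s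
        using N True by (simp add: e' e'p u_def)
      then show ?thesis by blast
    next
      case False
      then obtain c where "\<forall>s\<in>S. x s = (\<Sum>j<p. c j * e j s)" using comb \<open>x \<in> insert b B\<close> by auto
      then have "\<forall>s\<in>S. x s = (\<Sum>j<Suc p. (c(p := 0)) j * e' j s)" by (simp add: e')
      then show ?thesis by blast
    qed
    ultimately show ?thesis
      using p insert.hyps by (intro exI[of _ "Suc p"] exI[of _ e']) auto
  qed
qed

lemma orthonormal_frame_span:
  fixes B :: "('a \<Rightarrow> real) set"
  assumes "finite B" "finite S"
  obtains p e where "p \<le> card B"
    "\<And>i j. i < p \<Longrightarrow> j < p \<Longrightarrow> (\<Sum>s\<in>S. e i s * e j s) = of_bool (i = j)"
    "\<And>v. v \<in> fun_space.span B \<Longrightarrow> \<exists>c. \<forall>s\<in>S. v s = (\<Sum>j<p. c j * e j s)"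
proof -
  obtain p and e :: "nat \<Rightarrow> 'a \<Rightarrow> real" where p: "p \<le> card B"
    and orth: "\<And>i j. i < p \<Longrightarrow> j < p \<Longrightarrow> (\<Sum>s\<in>S. e i s * e j s) = of_bool (i = j)"
    and comb: "\<And>b. b \<in> B \<Longrightarrow> \<exists>c. \<forall>s\<in>S. b s = (\<Sum>j<p. c j * e j s)"
    using gram_schmidt[OF assms] by blast
  have "\<exists>c. \<forall>s\<in>S. v s = (\<Sum>j<p. c j * e j s)" if "v \<in> fun_space.span B" for v
    using that
  proof (induction rule: fun_space.span_induct_alt)
    case base
    then show ?case by (intro exI[of _ "\<lambda>_. 0"]) simp
  next
    case (step r x y)
    obtain c c' where "\<forall>s\<in>S. x s = (\<Sum>j<p. c j * e j s)" "\<forall>s\<in>S. y s = (\<Sum>j<p. c' j * e j s)"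
      using step comb by blast
    then show ?case
      by (intro exI[of _ "\<lambda>j. r * c j + c' j"])
         (simp add: sum_distrib_left sum.distrib algebra_simps)
  qed
  with p orth that show thesis by blast
qed

text \<open>The square root is the length of the projection of \<open>x\<close> onto the frame. In
  frame coordinates the claim is the Cauchy-Schwarz inequality, since the coefficients of
  \<open>v\<close> have the same norm as \<open>v\<close>.\<close>

lemma inner_le_orthonormal_frame:
  fixes e :: "nat \<Rightarrow> 'a \<Rightarrow> real"
  assumes orth: "\<And>i j. i < p \<Longrightarrow> j < p \<Longrightarrow> (\<Sum>s\<in>S. e i s * e j s) = of_bool (i = j)"
    and v: "\<forall>s\<in>S. v s = (\<Sum>j<p. c j * e j s)"
  shows "\<bar>\<Sum>s\<in>S. v s * x s\<bar> \<le> L2_set v S * sqrt (\<Sum>j<p. (\<Sum>s\<in>S. e j s * x s)\<^sup>2)"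
proof -
  define X where "X j = (\<Sum>s\<in>S. e j s * x s)" for j
  have "(\<Sum>s\<in>S. v s * x s) = (\<Sum>s\<in>S. \<Sum>j<p. c j * (e j s * x s))"
    using v by (intro sum.cong refl) (simp add: sum_distrib_right mult.assoc)
  also have "\<dots> = (\<Sum>j<p. c j * X j)"
    unfolding X_def by (subst sum.swap) (simp add: sum_distrib_left)
  also have "\<bar>\<dots>\<bar> \<le> (\<Sum>j<p. \<bar>c j\<bar> * \<bar>X j\<bar>)"
    by (rule order_trans[OF sum_abs]) (simp add: abs_mult)
  also have "\<dots> \<le> L2_set c {..<p} * L2_set X {..<p}"
    by (rule L2_set_mult_ineq)
  also have "L2_set c {..<p} = L2_set v S"
  proof -
    have "(\<Sum>s\<in>S. (v s)\<^sup>2) = (\<Sum>j<p. (c j)\<^sup>2)"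
      using orthonormal_combination_norm[where S = S and c = c, OF orth] v by simp
    then show ?thesis by (simp add: L2_set_def)
  qed
  finally show ?thesis by (simp add: L2_set_def X_def)
qed

text \<open>This form reduces finiteness and cardinality of the grid to the facts about
  \<open>PiE\<close>.\<close>

lemma grid_eq_image: "(grid n :: (nat ^ 'd) set) = vec_lambda ` (UNIV \<rightarrow>\<^sub>E {1..n})"
proof (intro set_eqI iffI)
  fix s :: "nat ^ 'd" assume "s \<in> grid n"
  then show "s \<in> vec_lambda ` (UNIV \<rightarrow>\<^sub>E {1..n})"
    by (intro image_eqI[of _ _ "vec_nth s"]) (auto simp: grid_def)
qed (auto simp: grid_def PiE_iff)

lemma finite_grid [simp]: "finite (grid n)"
  unfolding grid_eq_image by (intro finite_imageI finite_PiE) auto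

lemma card_grid: "card (grid n :: (nat ^ 'd) set) = n ^ CARD('d)"
  unfolding grid_eq_image
  by (subst card_image) (auto simp: card_PiE inj_on_def vec_lambda_inject)

text \<open>The union of bases of the fragment spaces generates the partition space. The result is a
  generating set of controlled size, to which orthonormalisation applies.\<close>

lemma partition_space_frame:
  fixes G :: "(real ^ 'd \<Rightarrow> real) set"
  assumes "finite Q" and dim: "\<And>P. P \<in> Q \<Longrightarrow> fun_space.dim (fragment_space G n P) \<le> K"
  obtains B where "finite B" "card B \<le> K * card Q" "partition_space G n Q \<subseteq> fun_space.span B"
proof -
  \<comment> \<open>The ambient space of functions is infinite-dimensional, and \<open>dim\<close>
    is also \<open>0\<close> for a space with an infinite basis. The finitely many unit vectors on
    the grid generate every fragment space and thereby make its bases finite.\<close>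
  define I :: "(nat ^ 'd \<Rightarrow> real) set" where "I = (\<lambda>t s. of_bool (s = t)) ` grid n"
  have I: "fragment_space G n P \<subseteq> fun_space.span I" for P
  proof
    fix h assume "h \<in> fragment_space G n P"
    then have h: "h s = 0" if "s \<notin> grid n" for s
      using that by (auto simp: fragment_space_def discretise_def)
    have *: "(\<Sum>t\<in>A. (\<lambda>s. h t * of_bool (s = t))) s = (\<Sum>t\<in>A. h t * of_bool (s = t))"
      if "finite A" for s A
      using that by induction auto
    have "h = (\<Sum>t\<in>grid n. (\<lambda>s. h t * of_bool (s = t)))"
    proof
      fix s
      have "(\<Sum>t\<in>grid n. h t * of_bool (s = t)) = (\<Sum>t\<in>grid n. if s = t then h t else 0)"
        by (intro sum.cong) auto
      then show "h s = (\<Sum>t\<in>grid n. (\<lambda>s. h t * of_bool (s = t))) s"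
        unfolding *[OF finite_grid] using h[of s] by simp
    qed
    moreover have "\<dots> \<in> fun_space.span I"
      by (intro fun_space.span_sum fun_space.span_scale fun_space.span_base) (auto simp: I_def)
    ultimately show "h \<in> fun_space.span I" by simp
  qed
  have "\<exists>B. finite B \<and> card B \<le> K \<and> fragment_space G n P \<subseteq> fun_space.span B" if P: "P \<in> Q" for P
  proof -
    obtain B where B: "B \<subseteq> fragment_space G n P" "fun_space.independent B"
      "fragment_space G n P \<subseteq> fun_space.span B" "card B = fun_space.dim (fragment_space G n P)"
      using fun_space.basis_exists by blast
    have "finite B"
      using fun_space.independent_span_bound[OF _ B(2), of I] B(1) I[of P] by (auto simp: I_def)
    with B dim[OF P] show ?thesis by auto
  qed
  then obtain B where B: "\<And>P. P \<in> Q \<Longrightarrow> finite (B P)" "\<And>P. P \<in> Q \<Longrightarrow> card (B P) \<le> K"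
    "\<And>P. P \<in> Q \<Longrightarrow> fragment_space G n P \<subseteq> fun_space.span (B P)"
    by metis
  have "card (\<Union>P\<in>Q. B P) \<le> (\<Sum>P\<in>Q. card (B P))"
    using assms(1) by (rule card_UN_le)
  also have "\<dots> \<le> K * card Q" using sum_bounded_above[of Q "\<lambda>P. card (B P)" K] B by (simp add: mult.commute)
  finally have "card (\<Union>P\<in>Q. B P) \<le> K * card Q" .
  moreover have "partition_space G n Q \<subseteq> fun_space.span (\<Union>P\<in>Q. B P)"
    unfolding partition_space_def
    by (intro fun_space.span_minimal fun_space.subspace_span)
       (use B(3) fun_space.span_mono in blast)
  ultimately show thesis using that[of "\<Union>P\<in>Q. B P"] B(1) assms(1) by blast
qed

subsection \<open>The noise over all partitions\<close>

text \<open>Each \<open>Q\<close> gets one exceptional event, of probability at most a constant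
  times \<open>card R powr (- K)\<close> times \<open>a ^ card Q\<close>, where
  \<open>a = A ^ D / card R\<close>. Summed over all subsets of \<open>R\<close>, the powers give
  \<open>(1 + a) ^ card R \<le> exp (A ^ D)\<close>, a bound free of \<open>card R\<close>. The
  dimension \<open>D\<close> thus enters only the constant and not the noise level. The extra
  \<open>1\<close> in the size of \<open>B\<close> leaves room for a competitor.\<close>

lemma (in prob_space) noise_bound:
  fixes \<xi> :: "'s \<Rightarrow> 'a \<Rightarrow> real" and S :: "'s set" and R :: "'p set"
    and V :: "'p set \<Rightarrow> ('s \<Rightarrow> real) set" and D :: nat and \<beta> \<epsilon> K :: real
  assumes S: "finite S" and \<xi>: "\<And>s. s \<in> S \<Longrightarrow> \<xi> s \<in> borel_measurable M"
    and R: "finite R" "R \<noteq> {}" and \<beta>: "\<beta> > 0" and \<epsilon>: "0 < \<epsilon>" "\<epsilon> < 1" and K: "K \<ge> 0"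
    and tail: "\<And>\<mu> c. c \<ge> 0 \<Longrightarrow> prob {\<omega> \<in> space M. \<bar>\<Sum>s\<in>S. \<mu> s * \<xi> s \<omega>\<bar> \<ge> c}
        \<le> 2 * exp (- (c\<^sup>2 / (\<beta> * (\<Sum>s\<in>S. (\<mu> s)\<^sup>2))))"
    and Q: "\<Q> \<subseteq> Pow R"
    and V: "\<And>Q. Q \<in> \<Q> \<Longrightarrow> \<exists>B. finite B \<and> card B \<le> D * card Q + 1 \<and> V Q \<subseteq> fun_space.span B"
  defines "A \<equiv> 4 * exp (1 / \<epsilon>)"
  shows "\<exists>E\<in>events. prob E \<le> 2 * A * exp (A ^ D) * real (card R) powr (- K) \<and>
    (\<forall>\<omega>\<in>space M - E. \<forall>Q\<in>\<Q>. \<forall>v\<in>V Q.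
       \<bar>\<Sum>s\<in>S. v s * \<xi> s \<omega>\<bar>
         \<le> L2_set v S * sqrt ((real (card Q) + K) * (\<beta> * ln (real (card R)) / (1 - \<epsilon>))))"
proof -
  define L where "L = ln (real (card R))"
  have cR: "card R \<ge> 1" using R by (simp add: Suc_leI card_gt_0_iff)
  have L: "L \<ge> 0" using cR by (simp add: L_def)
  \<comment> \<open>Chosen so that
    \<open>(1 - \<epsilon>) * y Q / \<beta> = (card Q + K) * L\<close>: the part
    \<open>card Q * L\<close> pays for the number of partitions, the part \<open>K * L\<close> is
    left over as decay.\<close>
  define y where "y Q = (real (card Q) + K) * (\<beta> * L / (1 - \<epsilon>))" for Q :: "'p set"
  have y: "y Q \<ge> 0" for Q unfolding y_def using K L \<beta> \<epsilon> by auto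
  have "exp (1 / \<epsilon>) \<ge> 1" using \<epsilon> by simp
  then have A1: "A \<ge> 1" unfolding A_def by linarith
  define a where "a = A ^ D * exp (- L)"
  have a0: "a \<ge> 0" using A1 by (simp add: a_def)
  have "\<exists>E\<in>events. prob E \<le> 2 * A * exp (- K * L) * a ^ card Q \<and>
      (\<forall>\<omega>\<in>space M - E. \<forall>v\<in>V Q. \<bar>\<Sum>s\<in>S. v s * \<xi> s \<omega>\<bar> \<le> L2_set v S * sqrt (y Q))"
    if Q: "Q \<in> \<Q>" for Q
  proof -
    obtain B where B: "finite B" "card B \<le> D * card Q + 1" "V Q \<subseteq> fun_space.span B"
      using V[OF Q] by blast
    obtain p e where p: "p \<le> card B"
      and orth: "\<And>i j. i < p \<Longrightarrow> j < p \<Longrightarrow> (\<Sum>s\<in>S. e i s * e j s) = of_bool (i = j)"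
      and comb: "\<And>v. v \<in> fun_space.span B \<Longrightarrow> \<exists>c. \<forall>s\<in>S. v s = (\<Sum>j<p. c j * e j s)"
      using orthonormal_frame_span[OF B(1) S] by blast
    define X where "X j \<omega> = (\<Sum>s\<in>S. e j s * \<xi> s \<omega>)" for j \<omega>
    have X: "X j \<in> borel_measurable M" for j unfolding X_def using \<xi> by measurable
    define E where "E = {\<omega> \<in> space M. (\<Sum>j<p. (X j \<omega>)\<^sup>2) \<ge> y Q}"
    have E: "E \<in> events" unfolding E_def using X by measurable
    have "prob E \<le> 2 * A ^ p * exp (- ((1 - \<epsilon>) * y Q / \<beta>))"
      unfolding E_def A_def
    proof (rule subgaussian_sum_squares_tail[OF X \<beta> \<epsilon> y])
      fix w :: "nat \<Rightarrow> real" and c :: real assume c: "c \<ge> 0"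
      \<comment> \<open>A combination of the \<open>X j\<close> is a linear functional of the noise,
        and by orthonormality its coefficient vector has the norm of \<open>w\<close>. Hence the
        tail hypothesis passes from the noise to the \<open>X j\<close>.\<close>
      have 1: "(\<Sum>s\<in>S. (\<Sum>j<p. w j * e j s) * \<xi> s \<omega>) = (\<Sum>j<p. w j * X j \<omega>)" for \<omega>
        unfolding X_def by (simp add: sum_distrib_left sum_distrib_right mult.assoc) (rule sum.swap)
      have 2: "(\<Sum>s\<in>S. (\<Sum>j<p. w j * e j s)\<^sup>2) = (\<Sum>j<p. (w j)\<^sup>2)"
        by (rule orthonormal_combination_norm[OF orth])
      show "prob {\<omega> \<in> space M. c \<le> \<bar>\<Sum>j<p. w j * X j \<omega>\<bar>}
          \<le> 2 * exp (- (c\<^sup>2 / (\<beta> * (\<Sum>j<p. (w j)\<^sup>2))))"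
        using tail[OF c, of "\<lambda>s. \<Sum>j<p. w j * e j s"]
        unfolding 1 2 .
    qed
    also have "(1 - \<epsilon>) * y Q / \<beta> = (card Q + K) * L" using \<beta> \<epsilon> by (simp add: y_def)
    also have "A ^ p \<le> A ^ (D * card Q + 1)" using p B(2) A1 by (intro power_increasing) auto
    also have "2 * A ^ (D * card Q + 1) * exp (- ((card Q + K) * L)) = 2 * A * exp (- K * L) * a ^ card Q"
    proof -
      have "exp (- ((card Q + K) * L)) = exp (- K * L) * exp (- L) ^ card Q"
        unfolding exp_of_nat_mult[symmetric] by (simp add: algebra_simps flip: exp_add)
      then show ?thesis by (simp add: a_def power_mult_distrib power_mult)
    qed
    finally have "prob E \<le> 2 * A * exp (- K * L) * a ^ card Q" by simp
    moreover have "\<bar>\<Sum>s\<in>S. v s * \<xi> s \<omega>\<bar> \<le> L2_set v S * sqrt (y Q)"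
      if \<omega>: "\<omega> \<in> space M - E" and v: "v \<in> V Q" for \<omega> v
    proof -
      obtain c where "\<forall>s\<in>S. v s = (\<Sum>j<p. c j * e j s)" using comb B(3) v by blast
      then have "\<bar>\<Sum>s\<in>S. v s * \<xi> s \<omega>\<bar> \<le> L2_set v S * sqrt (\<Sum>j<p. (X j \<omega>)\<^sup>2)"
        unfolding X_def by (rule inner_le_orthonormal_frame[where c = c, rotated]) (rule orth)
      also have "\<dots> \<le> L2_set v S * sqrt (y Q)"
        using \<omega> by (intro mult_left_mono) (auto simp: E_def)
      finally show ?thesis .
    qed
    ultimately show ?thesis using E by blast
  qed
  then have "\<forall>Q\<in>\<Q>. \<exists>E. E \<in> events \<and> prob E \<le> 2 * A * exp (- K * L) * a ^ card Q \<and>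
      (\<forall>\<omega>\<in>space M - E. \<forall>v\<in>V Q. \<bar>\<Sum>s\<in>S. v s * \<xi> s \<omega>\<bar> \<le> L2_set v S * sqrt (y Q))"
    by (simp add: Bex_def)
  from bchoice[OF this] obtain E where E: "\<And>Q. Q \<in> \<Q> \<Longrightarrow> E Q \<in> events"
    and PE: "\<And>Q. Q \<in> \<Q> \<Longrightarrow> prob (E Q) \<le> 2 * A * exp (- K * L) * a ^ card Q"
    and good: "\<And>Q \<omega> v. Q \<in> \<Q> \<Longrightarrow> \<omega> \<in> space M - E Q \<Longrightarrow> v \<in> V Q
        \<Longrightarrow> \<bar>\<Sum>s\<in>S. v s * \<xi> s \<omega>\<bar> \<le> L2_set v S * sqrt (y Q)"
    by blast
  have finQ: "finite \<Q>" using Q R finite_subset by blast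
  have "prob (\<Union>Q\<in>\<Q>. E Q) \<le> (\<Sum>Q\<in>\<Q>. prob (E Q))"
    using E finQ by (intro finite_measure_subadditive_finite) auto
  also have "\<dots> \<le> (\<Sum>Q\<in>\<Q>. 2 * A * exp (- K * L) * a ^ card Q)"
    using PE by (intro sum_mono)
  \<comment> \<open>Over the whole power set, the sum of the \<open>a ^ card Q\<close> is the
    binomial expansion of \<open>(1 + a) ^ card R\<close>.\<close>
  also have "\<dots> \<le> (\<Sum>Q\<in>Pow R. 2 * A * exp (- K * L) * a ^ card Q)"
    using Q R A1 a0 by (intro sum_mono2) auto
  also have "\<dots> = 2 * A * exp (- K * L) * (1 + a) ^ card R"
    using prod_add[OF R(1), of "\<lambda>_. a" "\<lambda>_. 1"] by (simp add: sum_distrib_left add.commute)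
  also have "\<dots> \<le> 2 * A * exp (- K * L) * exp (A ^ D)"
  proof -
    have "(1 + a) ^ card R \<le> exp a ^ card R"
      using a0 by (intro power_mono) auto
    also have "\<dots> = exp (card R * a)" by (simp add: exp_of_nat_mult)
    also have "card R * a = A ^ D" using cR by (simp add: a_def L_def exp_minus)
    finally show ?thesis using A1 by (intro mult_left_mono) auto
  qed
  also have "exp (- K * L) = real (card R) powr (- K)"
    using cR by (simp add: powr_def L_def)
  finally have "prob (\<Union>Q\<in>\<Q>. E Q) \<le> 2 * A * exp (A ^ D) * real (card R) powr (- K)"
    by (simp add: mult_ac)
  moreover have "(\<Union>Q\<in>\<Q>. E Q) \<in> events" using E finQ by auto
  ultimately show ?thesis
    using good unfolding y_def L_def by (intro bexI[of _ "\<Union>Q\<in>\<Q>. E Q"] conjI ballI) auto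
qed

subsection \<open>Step functions on the cube\<close>

lemma cell_borel [measurable]: "cell n (s :: nat ^ 'd) \<in> sets borel"
proof -
  have [measurable]: "(\<lambda>x :: real ^ 'd. x $ j) \<in> borel_measurable borel" for j :: 'd
    by (intro borel_measurable_continuous_onI continuous_intros)
  have "{x \<in> space borel. \<forall>j. (real (s $ j) - 1) / real n \<le> x $ j \<and> x $ j < real (s $ j) / real n} \<in> sets borel"
    by measurable
  then show ?thesis by (simp add: cell_def)
qed

text \<open>The half-open cell lies between the open and the closed box with the same corners, whose
  measures agree.\<close>

lemma measure_cell:
  fixes s :: "nat ^ 'd"
  assumes "n \<ge> 1"
  shows "emeasure lebesgue (cell n s) \<noteq> \<infinity>" and "measure lebesgue (cell n s) = 1 / real n ^ CARD('d)"
proof -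
  define a :: "real ^ 'd" where "a = (\<chi> j. (real (s $ j) - 1) / real n)"
  define b :: "real ^ 'd" where "b = (\<chi> j. real (s $ j) / real n)"
  have le: "a \<le> b" using assms by (auto simp: a_def b_def less_eq_vec_def divide_right_mono)
  have sub: "box a b \<subseteq> cell n s" "cell n s \<subseteq> cbox a b"
    by (auto simp: cell_def mem_box_cart a_def b_def less_imp_le)
  have cell: "cell n s \<in> sets lebesgue" by simp
  have "emeasure lebesgue (cell n s) \<le> emeasure lebesgue (cbox a b)"
    using sub by (intro emeasure_mono) auto
  also have "\<dots> < \<infinity>" using emeasure_lborel_cbox_finite[of a b] by simp
  finally show fin: "emeasure lebesgue (cell n s) \<noteq> \<infinity>" by simp
  have m: "measure lebesgue (cbox a b) = 1 / real n ^ CARD('d)"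
    using le assms
    by (simp add: content_cbox_cart interval_ne_empty_cart less_eq_vec_def a_def b_def
        diff_divide_distrib[symmetric] power_one_over)
  have "measure lebesgue (box a b) \<le> measure lebesgue (cell n s)"
    using sub fin by (intro measure_mono_fmeasurable) (auto simp: fmeasurable_def less_top)
  moreover have "measure lebesgue (cell n s) \<le> measure lebesgue (cbox a b)"
    using sub by (intro measure_mono_fmeasurable) auto
  moreover have "measure lebesgue (box a b) = measure lebesgue (cbox a b)"
    by (simp add: measure_lborel_box_eq measure_lborel_cbox_eq)
  ultimately show "measure lebesgue (cell n s) = 1 / real n ^ CARD('d)" using m by simp
qed

text \<open>Cells become fibres of a coordinatewise floor map; disjointness and the covering of the
  cube follow from this.\<close>

lemma cell_eq_floor:
  assumes n: "n \<ge> 1"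
  shows "cell n s = {x. \<forall>j. \<lfloor>real n * x $ j\<rfloor> = int (s $ j) - 1}"
proof -
  have "(real k - 1) / real n \<le> x \<and> x < real k / real n \<longleftrightarrow> \<lfloor>real n * x\<rfloor> = int k - 1" for k and x :: real
  proof -
    have "(real k - 1) / real n \<le> x \<and> x < real k / real n
        \<longleftrightarrow> real_of_int (int k - 1) \<le> real n * x \<and> real n * x < real_of_int (int k - 1) + 1"
      using n by (simp add: pos_divide_le_eq pos_less_divide_eq mult.commute)
    then show ?thesis by (simp only: floor_eq_iff)
  qed
  then show ?thesis unfolding cell_def by (simp only:)
qed

lemma cell_disjoint:
  assumes "n \<ge> 1" "x \<in> cell n s" "x \<in> cell n t"
  shows "s = t"
proof (rule vec_eq_iff[THEN iffD2], rule allI)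
  fix j
  have "\<lfloor>real n * x $ j\<rfloor> = int (s $ j) - 1" "\<lfloor>real n * x $ j\<rfloor> = int (t $ j) - 1"
    using assms by (simp_all add: cell_eq_floor)
  then show "s $ j = t $ j" by linarith
qed

lemma cube_eq_cells:
  assumes n: "n \<ge> 1"
  shows "cube = (\<Union>s\<in>grid n. cell n s)"
proof (intro equalityI subsetI)
  fix x :: "real ^ 'd" assume x: "x \<in> cube"
  define s :: "nat ^ 'd" where "s = (\<chi> j. nat \<lfloor>real n * x $ j\<rfloor> + 1)"
  have fl: "0 \<le> \<lfloor>real n * x $ j\<rfloor>" "\<lfloor>real n * x $ j\<rfloor> < int n" for j
    using x n by (auto simp: cube_def floor_less_iff)
  have s: "s \<in> grid n" using fl by (auto simp: grid_def s_def nat_less_iff Suc_le_eq)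
  have "x \<in> cell n s"
    unfolding cell_eq_floor[OF n] using fl by (simp add: s_def)
  with s show "x \<in> (\<Union>s\<in>grid n. cell n s)" by blast
next
  fix x :: "real ^ 'd" assume "x \<in> (\<Union>s\<in>grid n. cell n s)"
  then obtain s where s: "s \<in> grid n" "x \<in> cell n s" by blast
  have "0 \<le> x $ j \<and> x $ j < 1" for j
  proof -
    have sj: "1 \<le> s $ j" "s $ j \<le> n" and x: "(real (s $ j) - 1) / real n \<le> x $ j" "x $ j < real (s $ j) / real n"
      using s by (auto simp: grid_def cell_def)
    have "0 \<le> (real (s $ j) - 1) / real n" "real (s $ j) / real n \<le> 1" using sj n by auto
    with x show ?thesis by linarith
  qed
  then show "x \<in> cube" by (simp add: cube_def)
qed

lemma step_fun_cell:
  assumes "n \<ge> 1" "s \<in> grid n" "x \<in> cell n s"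
  shows "step_fun n z x = z s"
proof -
  have "z t * indicator (cell n t) x = (if t = s then z t else 0)" for t
  proof (cases "t = s")
    case False
    then have "x \<notin> cell n t" using cell_disjoint[OF assms(1)] assms(3) by blast
    with False show ?thesis by simp
  qed (use assms in simp)
  then show ?thesis using assms by (simp add: step_fun_def)
qed

text \<open>This is Pythagoras: the cell averages give the orthogonal projection of \<open>f\<close>
  onto the step functions, and \<open>R\<close> is the squared distance of \<open>f\<close> from
  them. That \<open>R\<close> does not depend on \<open>z\<close> allows comparisons on the grid to
  be transferred to the cube.\<close>

lemma L2_dist_step_fun:
  fixes f :: "real ^ 'd \<Rightarrow> real"
  assumes n: "n \<ge> 1" and f: "f \<in> L2"
  obtains R where "R \<ge> 0"
    "\<And>z. (L2_norm (\<lambda>x. step_fun n z x - f x))\<^sup>2 =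
      (L2_set (\<lambda>s. z s - discretise n f s) (grid n))\<^sup>2 / real (card (grid n :: (nat ^ 'd) set)) + R"
proof -
  define N where "N = real (card (grid n :: (nat ^ 'd) set))"
  have N: "N = real n ^ CARD('d)" "N > 0" using n by (auto simp: N_def card_grid)
  define g where "g = discretise n f"
  define J where "J s = (\<integral>x. (f x)\<^sup>2 \<partial>lebesgue_on (cell n s))" for s
  \<comment> \<open>Each summand is the integral of \<open>(f x - g s)\<^sup>2\<close> over the cell
    of \<open>s\<close>.\<close>
  define R where "R = (\<Sum>s\<in>grid n. J s - (g s)\<^sup>2 / N)"
  have cube_sets: "(cube :: (real ^ 'd) set) \<in> sets lebesgue"
    unfolding cube_eq_cells[OF n] by (intro sets.finite_UN) auto
  have cell_sets: "cell n s \<in> sets lebesgue" for s :: "nat ^ 'd" by simp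
  have sub: "cell n s \<subseteq> cube" if "s \<in> grid n" for s :: "nat ^ 'd"
    unfolding cube_eq_cells[OF n] using that by blast
  have fcube: "f \<in> borel_measurable (lebesgue_on cube)" "integrable (lebesgue_on cube) (\<lambda>x. (f x)\<^sup>2)"
    using f by (auto simp: L2_def)
  have fin: "finite_measure (lebesgue_on (cell n s))" for s :: "nat ^ 'd"
    using measure_cell[OF n, of s]
    by (intro finite_measure_lebesgue_on) (simp add: fmeasurable_def less_top)
  have fm: "f \<in> borel_measurable (lebesgue_on (cell n s))" if "s \<in> grid n" for s
    using measurable_restrict_mono[OF fcube(1) sub[OF that]] .
  have f2: "integrable (lebesgue_on (cell n s)) (\<lambda>x. (f x)\<^sup>2)" if s: "s \<in> grid n" for s
  proof -
    have "set_integrable lebesgue cube (\<lambda>x. (f x)\<^sup>2)"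
      using fcube(2) cube_sets by (simp add: integrable_restrict_space set_integrable_def)
    then have "set_integrable lebesgue (cell n s) (\<lambda>x. (f x)\<^sup>2)"
      by (rule set_integrable_subset) (use sub[OF s] in auto)
    then show ?thesis by (simp add: integrable_restrict_space set_integrable_def)
  qed
  have f1: "integrable (lebesgue_on (cell n s)) f" if s: "s \<in> grid n" for s
  proof -
    interpret finite_measure "lebesgue_on (cell n s)" by (rule fin)
    have "integrable (lebesgue_on (cell n s)) (\<lambda>x. 1 + (f x)\<^sup>2)" using f2[OF s] by simp
    \<comment> \<open>On a cell, which has finite measure, this makes the square integrable
      \<open>f\<close> integrable.\<close>
    moreover have "norm t \<le> norm (1 + t\<^sup>2)" for t :: real
      using zero_le_power2[of "\<bar>t\<bar> - 1"] zero_le_power2[of t] by (simp add: power2_diff)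
    ultimately show ?thesis
      by (rule Bochner_Integration.integrable_bound[OF _ fm[OF s] AE_I2])
  qed
  have int1: "(\<integral>x. f x \<partial>lebesgue_on (cell n s)) = g s / N" if "s \<in> grid n" for s
    using that N by (simp add: g_def discretise_def)
  have cell_int: "integrable (lebesgue_on (cell n s)) (\<lambda>x. (c - f x)\<^sup>2)"
    "(\<integral>x. (c - f x)\<^sup>2 \<partial>lebesgue_on (cell n s)) = c\<^sup>2 / N - 2 * c * (g s / N) + J s"
    if s: "s \<in> grid n" for s c
  proof -
    interpret finite_measure "lebesgue_on (cell n s)" by (rule fin)
    have eq: "(c - f x)\<^sup>2 = c\<^sup>2 - 2 * c * f x + (f x)\<^sup>2" for x by (simp add: power2_diff)
    have m: "measure (lebesgue_on (cell n s)) (cell n s) = 1 / N"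
      using measure_cell[OF n, of s] N by (simp add: measure_restrict_space)
    show "integrable (lebesgue_on (cell n s)) (\<lambda>x. (c - f x)\<^sup>2)"
      unfolding eq using f1[OF s] f2[OF s] by simp
    show "(\<integral>x. (c - f x)\<^sup>2 \<partial>lebesgue_on (cell n s)) = c\<^sup>2 / N - 2 * c * (g s / N) + J s"
      unfolding eq using f1[OF s] f2[OF s] int1[OF s] by (simp add: J_def m)
  qed
  have restrict: "(\<integral>x. h x \<partial>lebesgue_on A) = (LINT x:A|lebesgue. h x)"
    if "A \<in> sets lebesgue" for A and h :: "real ^ 'd \<Rightarrow> real"
    using that by (simp add: integral_restrict_space set_lebesgue_integral_def)
  have norm2: "(L2_norm h)\<^sup>2 = (\<integral>x. (h x)\<^sup>2 \<partial>lebesgue_on cube)" for h :: "real ^ 'd \<Rightarrow> real"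
    unfolding L2_norm_def by (simp add: integral_nonneg_AE)
  have main: "(L2_norm (\<lambda>x. step_fun n z x - f x))\<^sup>2 = (L2_set (\<lambda>s. z s - g s) (grid n))\<^sup>2 / N + R" for z
  proof -
    have on_cell: "(step_fun n z x - f x)\<^sup>2 = (z s - f x)\<^sup>2" if "s \<in> grid n" "x \<in> cell n s" for s x
      using step_fun_cell[OF n that] by simp
    have "(L2_norm (\<lambda>x. step_fun n z x - f x))\<^sup>2 = (LINT x:(\<Union>s\<in>grid n. cell n s)|lebesgue. (step_fun n z x - f x)\<^sup>2)"
      unfolding norm2 restrict[OF cube_sets] by (simp only: cube_eq_cells[OF n])
    also have "\<dots> = (\<Sum>s\<in>grid n. LINT x:cell n s|lebesgue. (step_fun n z x - f x)\<^sup>2)"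
    proof (rule set_integral_finite_Union)
      show "disjoint_family_on (cell n) (grid n)"
        using cell_disjoint[OF n] by (auto simp: disjoint_family_on_def)
      show "set_integrable lebesgue (cell n s) (\<lambda>x. (step_fun n z x - f x)\<^sup>2)" if s: "s \<in> grid n" for s
      proof -
        have "set_integrable lebesgue (cell n s) (\<lambda>x. (z s - f x)\<^sup>2)"
          using cell_int(1)[OF s] by (simp add: integrable_restrict_space set_integrable_def)
        then show ?thesis
          using on_cell[OF s] by (subst set_integrable_cong) auto
      qed
    qed auto
    also have "\<dots> = (\<Sum>s\<in>grid n. LINT x:cell n s|lebesgue. (z s - f x)\<^sup>2)"
      using on_cell by (intro sum.cong refl set_lebesgue_integral_cong) auto
    also have "\<dots> = (\<Sum>s\<in>grid n. (z s)\<^sup>2 / N - 2 * z s * (g s / N) + J s)"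
      using cell_int(2) by (simp add: restrict[OF cell_sets, symmetric])
    also have "\<dots> = (\<Sum>s\<in>grid n. (z s - g s)\<^sup>2 / N + (J s - (g s)\<^sup>2 / N))"
      by (intro sum.cong refl) (simp add: power2_diff diff_divide_distrib add_divide_distrib)
    also have "\<dots> = (\<Sum>s\<in>grid n. (z s - g s)\<^sup>2) / N + R"
      unfolding R_def sum.distrib by (simp add: sum_divide_distrib)
    finally show ?thesis by (simp add: L2_set_def sum_nonneg)
  qed
  \<comment> \<open>The choice \<open>z = g\<close> annihilates the grid distance, so
    \<open>R\<close> is itself a square.\<close>
  have "R = (L2_norm (\<lambda>x. step_fun n g x - f x))\<^sup>2"
    unfolding main by (simp add: L2_set_def)
  then have "R \<ge> 0" by simp
  then show thesis by (rule that) (rule main[unfolded g_def N_def])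
qed

subsection \<open>Penalised least squares\<close>

text \<open>The term \<open>2 * x * W\<close> is absorbed by completing the square and
  \<open>2 * b * W\<close> by Young's inequality, so \<open>W\<^sup>2\<close> appears with the
  factor \<open>1 + \<eta>\<close>. As \<theta> is strictly below \<open>1\<close>, a multiple of
  \<open>T * m\<close> survives on the left; it controls \<open>T * m\<close>, hence
  \<open>W\<close>, hence \<open>x\<close>.\<close>

lemma penalised_quadratic_bound:
  fixes \<theta> K :: real
  assumes "0 < \<theta>" "\<theta> < 1" "K \<ge> 0"
  obtains C where "C > 0"
    "\<And>x b W T m q :: real. T \<ge> 0 \<Longrightarrow> m \<ge> 0 \<Longrightarrow> q \<ge> 0 \<Longrightarrow> W\<^sup>2 \<le> \<theta> * T * (m + K) \<Longrightarrow>
       x\<^sup>2 \<le> T * (q - m) + b\<^sup>2 + 2 * (x + b) * W \<Longrightarrow> x\<^sup>2 \<le> C * (T * q + b\<^sup>2 + T)"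
proof -
  \<comment> \<open>Small enough for \<open>(1 + \<eta>) * \<theta> < 1\<close>; the gap is
    \<sigma>.\<close>
  define \<eta> where "\<eta> = (1 - \<theta>) / 2"
  define \<sigma> where "\<sigma> = 1 - (1 + \<eta>) * \<theta>"
  have \<eta>: "\<eta> > 0" using assms by (simp add: \<eta>_def)
  have "\<sigma> = (1 - \<theta>) * (2 - \<theta>) / 2" by (simp add: \<sigma>_def \<eta>_def field_simps)
  also have "\<dots> > 0" using assms by simp
  finally have \<sigma>: "\<sigma> > 0" .
  \<comment> \<open>The first factor comes from
    \<open>x\<^sup>2 \<le> 2 * (x - W)\<^sup>2 + 2 * W\<^sup>2\<close> with
    \<open>(x - W)\<^sup>2 \<le> Z\<close> and \<open>W\<^sup>2 \<le> Z / \<sigma> + Z\<close>; the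
    second compares \<open>Z\<close> with \<open>T * q + b\<^sup>2 + T\<close>.\<close>
  define C where "C = (4 + 2 / \<sigma>) * (1 + 1 / \<eta> + K)"
  have C: "C > 0" unfolding C_def using \<sigma> \<eta> assms by (intro mult_pos_pos add_pos_nonneg) auto
  have bound: "x\<^sup>2 \<le> C * (T * q + b\<^sup>2 + T)"
    if T: "T \<ge> 0" and m: "m \<ge> 0" and q: "q \<ge> 0" and W: "W\<^sup>2 \<le> \<theta> * T * (m + K)"
      and x: "x\<^sup>2 \<le> T * (q - m) + b\<^sup>2 + 2 * (x + b) * W" for x b W T m q :: real
  proof -
    define Z where "Z = T * q + (1 + 1 / \<eta>) * b\<^sup>2 + T * K"
    have young: "2 * b * W \<le> b\<^sup>2 / \<eta> + \<eta> * W\<^sup>2"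
    proof -
      have "0 \<le> (b - \<eta> * W)\<^sup>2 / \<eta>" using \<eta> by simp
      also have "\<dots> = b\<^sup>2 / \<eta> + \<eta> * W\<^sup>2 - 2 * b * W"
        using \<eta> by (simp add: power2_eq_square field_simps)
      finally show ?thesis by simp
    qed
    have "(1 + \<eta>) * W\<^sup>2 \<le> (1 + \<eta>) * (\<theta> * T * (m + K))" using W \<eta> by (intro mult_left_mono) auto
    also have "\<dots> = (1 - \<sigma>) * (T * m) + (1 - \<sigma>) * (T * K)" by (simp add: \<sigma>_def algebra_simps)
    also have "(1 - \<sigma>) * (T * K) \<le> T * K"
      using mult_right_mono[of "1 - \<sigma>" 1 "T * K"] \<sigma> T assms by simp
    finally have W1: "(1 + \<eta>) * W\<^sup>2 \<le> (1 - \<sigma>) * (T * m) + T * K" by simp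
    have main: "(x - W)\<^sup>2 + \<sigma> * (T * m) \<le> Z"
      using x young W1 unfolding Z_def by (simp add: power2_eq_square algebra_simps)
    have Tm: "T * m \<ge> 0" using T m by simp
    have xW: "(x - W)\<^sup>2 \<le> Z" using main mult_nonneg_nonneg[OF less_imp_le[OF \<sigma>] Tm] by linarith
    have "\<sigma> * (T * m) \<le> Z" using main zero_le_power2[of "x - W"] by linarith
    then have "T * m \<le> Z / \<sigma>" using \<sigma> by (simp add: field_simps)
    moreover have "T * K \<le> Z" unfolding Z_def using T q \<eta> by simp
    moreover have "W\<^sup>2 \<le> T * (m + K)"
      using W mult_right_mono[of \<theta> 1 "T * (m + K)"] assms T m by (simp add: mult.assoc)
    ultimately have W2: "W\<^sup>2 \<le> Z / \<sigma> + Z" by (simp add: distrib_left)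
    have "x\<^sup>2 \<le> 2 * (x - W)\<^sup>2 + 2 * W\<^sup>2"
      using zero_le_power2[of "x - 2 * W"] by (simp add: power2_eq_square algebra_simps)
    also have "\<dots> \<le> 2 * Z + 2 * (Z / \<sigma> + Z)" using xW W2 by (intro add_mono mult_left_mono) auto
    also have "\<dots> = (4 + 2 / \<sigma>) * Z" by (simp add: algebra_simps)
    also have "\<dots> \<le> (4 + 2 / \<sigma>) * ((1 + 1 / \<eta> + K) * (T * q + b\<^sup>2 + T))"
    proof (intro mult_left_mono)
      have "(1 + 1 / \<eta> + K) * (T * q + b\<^sup>2 + T) - Z = (1 / \<eta> + K) * (T * q) + K * b\<^sup>2 + (1 + 1 / \<eta>) * T"
        unfolding Z_def by (simp add: distrib_right distrib_left)
      also have "\<dots> \<ge> 0" using T q \<eta> assms by (intro add_nonneg_nonneg mult_nonneg_nonneg) auto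
      finally show "Z \<le> (1 + 1 / \<eta> + K) * (T * q + b\<^sup>2 + T)" by simp
    qed (use \<sigma> in auto)
    finally show ?thesis by (simp add: C_def mult.assoc)
  qed
  show thesis by (rule that[OF C]) (rule bound)
qed

text \<open>The value \<open>t1\<close> balances \<open>\<gamma> * t\<close> against
  \<open>t powr (- (2 * \<alpha>))\<close>, and \<open>t2\<close> balances
  \<open>t powr \<rho> / F\<close> against \<open>t powr (- \<alpha>)\<close>. Below both, the two
  growing terms are under control, while the decaying one is governed by whichever of
  \<open>t1\<close>, \<open>t2\<close> is smaller. Since \<open>t \<ge> 1\<close>, rounding down at
  most halves \<open>t\<close>, which costs the factor \<open>4 powr \<alpha>\<close>.\<close>

lemma balanced_cutoff:
  fixes \<gamma> F \<alpha> \<rho> :: real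
  assumes \<gamma>: "0 < \<gamma>" "\<gamma> \<le> 1" and F: "F \<ge> 1" and \<alpha>: "\<alpha> > 0" and \<rho>: "\<rho> \<ge> 0"
  shows "\<exists>k::nat\<ge>1. \<gamma> * real k + (real k powr \<rho> / F + 1 / real k powr \<alpha>)\<^sup>2
    \<le> (3 + 2 * 4 powr \<alpha>) * (\<gamma> powr (2 * \<alpha> / (2 * \<alpha> + 1)) + F powr (- (2 * \<alpha> / (\<alpha> + \<rho>))))"
proof -
  define a where "a = \<gamma> powr (2 * \<alpha> / (2 * \<alpha> + 1))"
  define b where "b = F powr (- (2 * \<alpha> / (\<alpha> + \<rho>)))"
  define t1 where "t1 = \<gamma> powr (- 1 / (2 * \<alpha> + 1))"
  define t2 where "t2 = F powr (1 / (\<alpha> + \<rho>))"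
  define t where "t = min t1 t2"
  have t1: "t1 \<ge> 1" unfolding t1_def using \<gamma> \<alpha> by (simp add: powr_minus_divide powr_le1 divide_simps)
  have t2: "t2 \<ge> 1" unfolding t2_def using F \<alpha> \<rho> by (intro ge_one_powr_ge_zero) auto
  have t: "t \<ge> 1" using t1 t2 by (simp add: t_def)
  define k where "k = nat \<lfloor>t\<rfloor>"
  have k1: "k \<ge> 1" unfolding k_def using t by (simp add: le_nat_iff)
  have "\<lfloor>t\<rfloor> \<ge> 1" using t by simp
  then have kt: "real k \<le> t" and tk: "t / 2 \<le> real k" unfolding k_def by linarith+
  have ab: "a \<ge> 0" "b \<ge> 0" by (simp_all add: a_def b_def)
  have "\<gamma> * real k \<le> \<gamma> powr 1 * t1" using kt \<gamma> by (simp add: t_def)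
  also have "\<dots> = a" unfolding t1_def a_def powr_add[symmetric] using \<alpha> by (simp add: divide_simps)
  finally have 1: "\<gamma> * real k \<le> a" .
  have 2: "(real k powr \<rho> / F)\<^sup>2 \<le> b"
  proof -
    have "real k powr \<rho> \<le> t2 powr \<rho>" using kt \<rho> by (intro powr_mono2) (auto simp: t_def)
    then have "real k powr \<rho> / F \<le> t2 powr \<rho> * F powr (- 1)"
      using F by (simp add: powr_minus_divide divide_right_mono)
    also have "\<dots> = F powr (- \<alpha> / (\<alpha> + \<rho>))"
      unfolding t2_def powr_powr powr_add[symmetric] using \<alpha> \<rho> by (simp add: divide_simps)
    finally have "(real k powr \<rho> / F)\<^sup>2 \<le> (F powr (- \<alpha> / (\<alpha> + \<rho>)))\<^sup>2"
      using F by (intro power_mono) auto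
    also have "\<dots> = b" using F by (simp add: b_def power2_eq_square flip: powr_add)
    finally show ?thesis .
  qed
  have 3: "(1 / real k powr \<alpha>)\<^sup>2 \<le> 4 powr \<alpha> * (a + b)"
  proof -
    have "(1 / real k powr \<alpha>)\<^sup>2 = real k powr (- (2 * \<alpha>))"
      using k1 by (simp add: power2_eq_square powr_minus_divide flip: powr_add)
    also have "\<dots> \<le> (t / 2) powr (- (2 * \<alpha>))" using tk t \<alpha> by (intro powr_mono2') auto
    also have "\<dots> = 4 powr \<alpha> * t powr (- (2 * \<alpha>))"
    proof -
      have "(4 :: real) powr \<alpha> = 2 powr (2 * \<alpha>)" using powr_powr[of 2 2 \<alpha>] by simp
      then show ?thesis using t by (simp add: powr_divide powr_minus_divide)
    qed
    also have "t powr (- (2 * \<alpha>)) \<le> a + b"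
    proof (cases "t1 \<le> t2")
      case True
      then have "t powr (- (2 * \<alpha>)) = a"
        unfolding t_def t1_def a_def by (simp add: powr_powr)
      then show ?thesis using ab by simp
    next
      case False
      then have "t powr (- (2 * \<alpha>)) = b"
        unfolding t_def t2_def b_def by (simp add: powr_powr)
      then show ?thesis using ab by simp
    qed
    finally show ?thesis by simp
  qed
  have "(real k powr \<rho> / F + 1 / real k powr \<alpha>)\<^sup>2 \<le> 2 * (real k powr \<rho> / F)\<^sup>2 + 2 * (1 / real k powr \<alpha>)\<^sup>2"
    using zero_le_power2[of "real k powr \<rho> / F - 1 / real k powr \<alpha>"]
    by (simp only: power2_sum power2_diff)
  then have "\<gamma> * real k + (real k powr \<rho> / F + 1 / real k powr \<alpha>)\<^sup>2 \<le> a + 2 * b + 2 * (4 powr \<alpha> * (a + b))"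
    using 1 2 3 by linarith
  also have "\<dots> \<le> (3 + 2 * 4 powr \<alpha>) * (a + b)" using ab by (simp add: algebra_simps)
  finally show ?thesis using k1 unfolding a_def b_def by blast
qed

text \<open>Assigning \<open>e n\<close> entirely to the larger of \<open>a n\<close> and
  \<open>b n\<close> gives an exact decomposition, because \<open>a n + b n\<close> is at most twice
  the maximum.\<close>

lemma bigo_sum_split:
  fixes e a b :: "nat \<Rightarrow> real"
  assumes le: "\<forall>\<^sub>F n in \<F>. e n \<le> K * (a n + b n)"
    and nonneg: "\<And>n. e n \<ge> 0" "\<And>n. a n \<ge> 0" "\<And>n. b n \<ge> 0" and K: "K \<ge> 0"
  shows "\<exists>A\<in>O[\<F>](a). \<exists>B\<in>O[\<F>](b). \<forall>n. e n = A n + B n"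
proof -
  define A where "A n = (if b n \<le> a n then e n else 0)" for n
  define B where "B n = (if b n \<le> a n then 0 else e n)" for n
  have *: "K * (x + y) \<le> 2 * K * max x y" for x y :: real
    using mult_left_mono[OF _ K, of "x + y" "2 * max x y"] by (auto simp: mult_ac)
  have "A \<in> O[\<F>](a)"
  proof (rule bigoI[of _ "2 * K"], rule eventually_mono[OF le])
    fix n assume "e n \<le> K * (a n + b n)"
    then show "norm (A n) \<le> 2 * K * norm (a n)"
      using *[of "a n" "b n"] nonneg[of n] K by (auto simp: A_def max_def split: if_splits)
  qed
  moreover have "B \<in> O[\<F>](b)"
  proof (rule bigoI[of _ "2 * K"], rule eventually_mono[OF le])
    fix n assume "e n \<le> K * (a n + b n)"
    then show "norm (B n) \<le> 2 * K * norm (b n)"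
      using *[of "a n" "b n"] nonneg[of n] K by (auto simp: B_def max_def split: if_splits)
  qed
  ultimately show ?thesis by (intro bexI[of _ A] bexI[of _ B]) (auto simp: A_def B_def)
qed

text \<open>After multiplication by \<open>N\<close> and expansion around \<open>g\<close>, the
  squared noise occurs on both sides and cancels, leaving only the noise tested against
  \<open>u - h\<close>.\<close>

lemma penalised_loss_basic_inequality:
  fixes n :: nat and u h g y z :: "nat ^ 'd \<Rightarrow> real"
  defines "N \<equiv> real (card (grid n :: (nat ^ 'd) set))"
  assumes N: "N > 0"
    and le: "penalised_loss n c y (P, u) \<le> penalised_loss n c y (Q, h)"
    and y: "\<And>s. s \<in> grid n \<Longrightarrow> y s = g s + z s"
  shows "(L2_set (\<lambda>s. u s - g s) (grid n))\<^sup>2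
    \<le> c * N * (real (card Q) - real (card P)) + (L2_set (\<lambda>s. h s - g s) (grid n))\<^sup>2
      + 2 * (\<Sum>s\<in>grid n. (u s - h s) * z s)"
proof -
  have L: "(L2_set v (grid n))\<^sup>2 = (\<Sum>s\<in>grid n. (v s)\<^sup>2)" for v :: "nat ^ 'd \<Rightarrow> real"
    by (simp add: L2_set_def sum_nonneg)
  have expand: "(\<Sum>s\<in>grid n. (v s - y s)\<^sup>2)
      = (\<Sum>s\<in>grid n. (v s - g s)\<^sup>2) - 2 * (\<Sum>s\<in>grid n. (v s - g s) * z s) + (\<Sum>s\<in>grid n. (z s)\<^sup>2)"
    for v :: "nat ^ 'd \<Rightarrow> real"
  proof -
    have "(v s - y s)\<^sup>2 = (v s - g s)\<^sup>2 - 2 * ((v s - g s) * z s) + (z s)\<^sup>2" if "s \<in> grid n" for s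
      by (simp add: y[OF that] power2_eq_square algebra_simps)
    then show ?thesis by (simp add: sum.distrib sum_subtractf sum_distrib_left)
  qed
  have "c * real (card P) * N + (\<Sum>s\<in>grid n. (u s - y s)\<^sup>2)
      \<le> c * real (card Q) * N + (\<Sum>s\<in>grid n. (h s - y s)\<^sup>2)"
    using mult_right_mono[OF le less_imp_le[OF N]] N
    by (simp add: penalised_loss_def L N_def[symmetric] distrib_right)
  moreover have "(\<Sum>s\<in>grid n. (u s - h s) * z s)
      = (\<Sum>s\<in>grid n. (u s - g s) * z s) - (\<Sum>s\<in>grid n. (h s - g s) * z s)"
    by (simp add: sum_subtractf[symmetric] algebra_simps)
  ultimately show ?thesis unfolding expand L by (simp add: algebra_simps)
qed

theorem theorem5:
  fixes \<MM> :: "nat set"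
    and \<Omega> :: "'w measure"
    and \<xi> :: "nat \<Rightarrow> nat ^ 'd \<Rightarrow> 'w \<Rightarrow> real"
    and G :: "(real ^ 'd \<Rightarrow> real) set"
    and \<R> :: "nat \<Rightarrow> (nat ^ 'd) set set"
    and \<PP> :: "nat \<Rightarrow> (nat ^ 'd) set set set"
    and f :: "real ^ 'd \<Rightarrow> real"
    and Y :: "nat \<Rightarrow> 'w \<Rightarrow> nat ^ 'd \<Rightarrow> real"
    and \<gamma> F :: "nat \<Rightarrow> real"
    and \<kappa> M \<beta> D \<alpha> C \<rho> :: real
    and Phat :: "nat \<Rightarrow> 'w \<Rightarrow> (nat ^ 'd) set set"
    and fhat :: "nat \<Rightarrow> 'w \<Rightarrow> nat ^ 'd \<Rightarrow> real"
  assumes MM: "infinite \<MM>" "0 \<notin> \<MM>"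
    and prob: "prob_space \<Omega>"
    and noise: "\<And>n s. n \<in> \<MM> \<Longrightarrow> s \<in> grid n \<Longrightarrow> \<xi> n s \<in> borel_measurable \<Omega>"
    and G: "finite_dim_L2_subspace G"
    and fragments: "\<And>n. n \<in> \<MM> \<Longrightarrow> \<R> n \<subseteq> Pow (grid n)"
    and partitions_nonempty: "\<And>n. n \<in> \<MM> \<Longrightarrow> \<PP> n \<noteq> {}"
    and partitions: "\<And>n Q. n \<in> \<MM> \<Longrightarrow> Q \<in> \<PP> n \<Longrightarrow> partition_on (grid n) Q \<and> Q \<subseteq> \<R> n"
    and f: "f \<in> L2"
    and data: "\<And>n \<omega> s. n \<in> \<MM> \<Longrightarrow> \<omega> \<in> space \<Omega> \<Longrightarrow> s \<in> grid n \<Longrightarrow>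
                 Y n \<omega> s = discretise n f s + \<xi> n s \<omega>"
    and pos1: "\<kappa> > 0" "M > 0"
    and many_fragments:
      "\<forall>\<^sub>F n in inf sequentially (principal \<MM>). real (card (\<R> n)) \<ge> M * real n powr \<kappa>"
    and pos2: "\<beta> > 0"
    and tail: "\<And>n \<mu> c. n \<in> \<MM> \<Longrightarrow> c \<ge> 0 \<Longrightarrow>
      measure \<Omega> {\<omega> \<in> space \<Omega>. \<bar>\<Sum>s\<in>grid n. \<mu> s * \<xi> n s \<omega>\<bar> \<ge> c}
        \<le> 2 * exp (- (c\<^sup>2 / (\<beta> * (\<Sum>s\<in>grid n. (\<mu> s)\<^sup>2))))"
    and gamma_pos: "\<And>n. n \<in> \<MM> \<Longrightarrow> \<gamma> n > 0"
    and gamma_lim: "(\<gamma> \<longlongrightarrow> 0) (inf sequentially (principal \<MM>))"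
    and dims: "\<And>n P. n \<in> \<MM> \<Longrightarrow> P \<in> \<R> n \<Longrightarrow> real (fun_space.dim (fragment_space G n P)) \<le> D"
    and gamma_large: "\<forall>\<^sub>F n in inf sequentially (principal \<MM>).
      \<gamma> n > \<beta> * D * ((\<kappa> + 1) / \<kappa>) *
        (ln (real (card (\<R> n))) / real (card (grid n :: (nat ^ 'd) set)))"
    and pos3: "\<alpha> > 0" "C > 0" "\<rho> \<ge> 0"
    and F_pos: "\<And>n. n \<in> \<MM> \<Longrightarrow> F n > 0"
    and F_lim: "filterlim F at_top (inf sequentially (principal \<MM>))"
    and approx: "\<And>n k::nat. n \<in> \<MM> \<Longrightarrow> k \<ge> 1 \<Longrightarrow>
      \<exists>(Q, h)\<in>segmentations G \<PP> n.
        card Q \<le> k \<and>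
        L2_norm (\<lambda>x. step_fun n h x - f x) \<le> C * (real k powr \<rho> / F n + 1 / real k powr \<alpha>)"
    and minimiser: "\<And>n \<omega>. n \<in> \<MM> \<Longrightarrow> \<omega> \<in> space \<Omega> \<Longrightarrow>
      is_arg_min (penalised_loss n (\<gamma> n) (Y n \<omega>)) (\<lambda>x. x \<in> segmentations G \<PP> n)
        (Phat n \<omega>, fhat n \<omega>)"
  shows "AE \<omega> in \<Omega>.
    \<exists>A \<in> O[inf sequentially (principal \<MM>)](\<lambda>n. \<gamma> n powr (2 * \<alpha> / (2 * \<alpha> + 1))).
    \<exists>B \<in> O[inf sequentially (principal \<MM>)](\<lambda>n. F n powr (- (2 * \<alpha> / (\<alpha> + \<rho>)))).
      \<forall>n\<in>\<MM>. (L2_norm (\<lambda>x. step_fun n (fhat n \<omega>) x - f x))\<^sup>2 = A n + B n"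
proof -

  \<comment> \<open>Notation and the choice of constants\<close>
  interpret prob_space \<Omega> by (rule prob)
  let ?\<F> = "inf sequentially (principal \<MM>)"
  have ev_iff: "eventually P ?\<F> \<longleftrightarrow> (\<forall>\<^sub>F n in sequentially. n \<in> \<MM> \<longrightarrow> P n)" for P
    by (simp add: eventually_inf_principal)
  define N where "N n = real (card (grid n :: (nat ^ 'd) set))" for n
  have n1: "n \<ge> 1" if "n \<in> \<MM>" for n using MM(2) that by (cases n) auto
  have N: "N n > 0" if "n \<in> \<MM>" for n using n1[OF that] by (simp add: N_def card_grid)
  define D' where "D' = nat \<lfloor>D\<rfloor>"
  have dim: "fun_space.dim (fragment_space G n P) \<le> D'" if "n \<in> \<MM>" "P \<in> \<R> n" for n P
    unfolding D'_def using dims[OF that] by (rule le_nat_floor)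
  \<comment> \<open>The factor \<open>(\<kappa> + 1) / \<kappa>\<close> of the penalty exceeds
    \<open>1\<close>. It is shared between the loss \<open>1 / (1 - \<epsilon>)\<close> in the noise
    bound and the slack \<open>\<theta> < 1\<close> needed for completing the square. With
    \<open>K = 2 / \<kappa>\<close>, the lower bound on the number of fragments turns
    \<open>card (\<R> n) powr (- K)\<close> into a multiple of \<open>n powr (- 2)\<close>, which is
    summable.\<close>
  define \<epsilon> where "\<epsilon> = 1 / (2 * (\<kappa> + 1))"
  define \<theta> where "\<theta> = 2 * \<kappa> / (2 * \<kappa> + 1)"
  define K where "K = 2 / \<kappa>"
  have \<epsilon>: "0 < \<epsilon>" "\<epsilon> < 1" and \<theta>: "0 < \<theta>" "\<theta> < 1" and K: "K \<ge> 0"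
    using pos1 by (auto simp: \<epsilon>_def \<theta>_def K_def)
  have \<epsilon>\<theta>: "\<theta> * ((\<kappa> + 1) / \<kappa>) = 1 / (1 - \<epsilon>)"
  proof -
    have "1 - \<epsilon> = (2 * \<kappa> + 1) / (2 * (\<kappa> + 1))" using pos1 by (simp add: \<epsilon>_def field_simps)
    then show ?thesis using pos1 by (simp add: \<theta>_def)
  qed
  have R: "finite (\<R> n)" "\<R> n \<noteq> {}" if n: "n \<in> \<MM>" for n
  proof -
    show "finite (\<R> n)" using finite_subset[OF fragments[OF n]] by simp
    obtain Q where "Q \<in> \<PP> n" using partitions_nonempty[OF n] by blast
    then have "partition_on (grid n) Q" "Q \<subseteq> \<R> n" using partitions[OF n] by auto
    moreover have "(grid n :: (nat ^ 'd) set) \<noteq> {}" using N[OF n] by (auto simp: N_def)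
    ultimately show "\<R> n \<noteq> {}" by (auto simp: partition_on_def)
  qed
  have finQ: "finite Q" "Q \<subseteq> \<R> n" if "n \<in> \<MM>" "Q \<in> \<PP> n" for n Q
    using partitions[OF that] finite_elements finite_grid by blast+

  \<comment> \<open>Choice of the number of fragments and of the competitor\<close>
  define a where "a n = \<gamma> n powr (2 * \<alpha> / (2 * \<alpha> + 1))" for n
  define b where "b n = F n powr (- (2 * \<alpha> / (\<alpha> + \<rho>)))" for n
  define K1 where "K1 = 3 + 2 * 4 powr \<alpha>"
  define r where "r n k = real k powr \<rho> / F n + 1 / real k powr \<alpha>" for n and k :: nat
  \<comment> \<open>The bound is conditional, so that \<open>k n\<close> is available for every
    \<open>n\<close>; both conditions hold for all large \<open>n\<close> in the index set.\<close>
  have "\<forall>n\<in>\<MM>. \<exists>k::nat\<ge>1. \<gamma> n \<le> 1 \<longrightarrow> F n \<ge> 1 \<longrightarrow> \<gamma> n * real k + (r n k)\<^sup>2 \<le> K1 * (a n + b n)"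
  proof
    fix n assume n: "n \<in> \<MM>"
    show "\<exists>k::nat\<ge>1. \<gamma> n \<le> 1 \<longrightarrow> F n \<ge> 1 \<longrightarrow> \<gamma> n * real k + (r n k)\<^sup>2 \<le> K1 * (a n + b n)"
    proof (cases "\<gamma> n \<le> 1 \<and> F n \<ge> 1")
      case True
      then show ?thesis
        using balanced_cutoff[OF gamma_pos[OF n] _ _ pos3(1,3), of "F n"]
        unfolding r_def K1_def a_def b_def by auto
    qed auto
  qed
  from bchoice[OF this] obtain k where k: "\<And>n. n \<in> \<MM> \<Longrightarrow> k n \<ge> 1"
    and k_bound: "\<And>n. n \<in> \<MM> \<Longrightarrow> \<gamma> n \<le> 1 \<Longrightarrow> F n \<ge> 1 \<Longrightarrow> \<gamma> n * real (k n) + (r n (k n))\<^sup>2 \<le> K1 * (a n + b n)"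
    by auto
  \<comment> \<open>The competitor does not depend on \<omega>, so it can be fixed before the
    exceptional events, which are built from it.\<close>
  have "\<forall>n\<in>\<MM>. \<exists>Qh. fst Qh \<in> \<PP> n \<and> snd Qh \<in> partition_space G n (fst Qh) \<and> card (fst Qh) \<le> k n \<and>
      L2_norm (\<lambda>x. step_fun n (snd Qh) x - f x) \<le> C * r n (k n)"
    using approx[OF _ k] unfolding r_def segmentations_def by fastforce
  from bchoice[OF this] obtain Qh where Qh: "\<forall>n\<in>\<MM>. fst (Qh n) \<in> \<PP> n \<and>
      snd (Qh n) \<in> partition_space G n (fst (Qh n)) \<and> card (fst (Qh n)) \<le> k n \<and>
      L2_norm (\<lambda>x. step_fun n (snd (Qh n)) x - f x) \<le> C * r n (k n)" ..
  define Q where "Q n = fst (Qh n)" for n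
  define h where "h n = snd (Qh n)" for n
  have Q: "Q n \<in> \<PP> n" and h: "h n \<in> partition_space G n (Q n)" and Qk: "card (Q n) \<le> k n"
    and h_err: "L2_norm (\<lambda>x. step_fun n (h n) x - f x) \<le> C * r n (k n)" if "n \<in> \<MM>" for n
    using Qh that by (auto simp: Q_def h_def)

  \<comment> \<open>Exceptional events of the noise and their summability\<close>
  define C0 where "C0 = 2 * (4 * exp (1 / \<epsilon>)) * exp ((4 * exp (1 / \<epsilon>)) ^ D')"
  have C0: "C0 \<ge> 0" by (simp add: C0_def)
  define y where "y n P = (real (card P) + K) * (\<beta> * ln (real (card (\<R> n))) / (1 - \<epsilon>))" for n and P :: "(nat ^ 'd) set set"
  have "\<forall>n\<in>\<MM>. \<exists>E. E \<in> events \<and> prob E \<le> C0 * real (card (\<R> n)) powr (- K) \<and>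
    (\<forall>\<omega>\<in>space \<Omega> - E. \<forall>P\<in>\<PP> n. \<forall>v\<in>(\<lambda>u. u - h n) ` partition_space G n P.
       \<bar>\<Sum>s\<in>grid n. v s * \<xi> n s \<omega>\<bar> \<le> L2_set v (grid n) * sqrt (y n P))"
  proof
    fix n assume n: "n \<in> \<MM>"
    have "\<exists>B. finite B \<and> card B \<le> D' * card P + 1 \<and> (\<lambda>u. u - h n) ` partition_space G n P \<subseteq> fun_space.span B"
      if P: "P \<in> \<PP> n" for P
    proof -
      obtain B where B: "finite B" "card B \<le> D' * card P" "partition_space G n P \<subseteq> fun_space.span B"
        using partition_space_frame[of P G n D'] finQ[OF n P] dim[OF n] by blast
      \<comment> \<open>Joining \<open>h n\<close> to the generating set captures all differences
        between an estimate and the competitor at the price of a single vector.\<close>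
      have "u - h n \<in> fun_space.span (insert (h n) B)" if "u \<in> partition_space G n P" for u
        using that B(3) fun_space.span_mono[of B "insert (h n) B"]
        by (intro fun_space.span_diff) (auto intro: fun_space.span_base)
      moreover have "card (insert (h n) B) \<le> D' * card P + 1"
        using B by (simp add: card_insert_if)
      ultimately show ?thesis using B(1) by (intro exI[of _ "insert (h n) B"]) auto
    qed
    moreover have "\<PP> n \<subseteq> Pow (\<R> n)" using finQ(2)[OF n] by blast
    ultimately have "\<exists>E\<in>events. prob E \<le> C0 * real (card (\<R> n)) powr (- K) \<and>
      (\<forall>\<omega>\<in>space \<Omega> - E. \<forall>P\<in>\<PP> n. \<forall>v\<in>(\<lambda>u. u - h n) ` partition_space G n P.
         \<bar>\<Sum>s\<in>grid n. v s * \<xi> n s \<omega>\<bar> \<le> L2_set v (grid n) * sqrt (y n P))"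
      unfolding C0_def y_def
      by (intro noise_bound[OF finite_grid noise[OF n] R[OF n] pos2 \<epsilon> K tail[OF n]])
    then show "\<exists>E. E \<in> events \<and> prob E \<le> C0 * real (card (\<R> n)) powr (- K) \<and>
      (\<forall>\<omega>\<in>space \<Omega> - E. \<forall>P\<in>\<PP> n. \<forall>v\<in>(\<lambda>u. u - h n) ` partition_space G n P.
         \<bar>\<Sum>s\<in>grid n. v s * \<xi> n s \<omega>\<bar> \<le> L2_set v (grid n) * sqrt (y n P))"
      by (simp only: Bex_def)
  qed
  from bchoice[OF this] obtain E where E_all: "\<forall>n\<in>\<MM>. E n \<in> events \<and> prob (E n) \<le> C0 * real (card (\<R> n)) powr (- K) \<and>
    (\<forall>\<omega>\<in>space \<Omega> - E n. \<forall>P\<in>\<PP> n. \<forall>v\<in>(\<lambda>u. u - h n) ` partition_space G n P.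
       \<bar>\<Sum>s\<in>grid n. v s * \<xi> n s \<omega>\<bar> \<le> L2_set v (grid n) * sqrt (y n P))" ..
  have E: "E n \<in> events" and PE: "prob (E n) \<le> C0 * real (card (\<R> n)) powr (- K)" if "n \<in> \<MM>" for n
    using E_all that by blast+
  have E_good: "\<bar>\<Sum>s\<in>grid n. (u s - h n s) * \<xi> n s \<omega>\<bar> \<le> L2_set (\<lambda>s. u s - h n s) (grid n) * sqrt (y n P)"
    if "n \<in> \<MM>" "\<omega> \<in> space \<Omega>" "\<omega> \<notin> E n" "P \<in> \<PP> n" "u \<in> partition_space G n P" for n \<omega> P u
  proof -
    have "\<bar>\<Sum>s\<in>grid n. (u - h n) s * \<xi> n s \<omega>\<bar> \<le> L2_set (u - h n) (grid n) * sqrt (y n P)"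
      using E_all that by blast
    then show ?thesis by (simp add: fun_diff_def)
  qed
  \<comment> \<open>Empty events off the index set give a sequence over all natural numbers, as the
    Borel-Cantelli lemma requires.\<close>
  define E' where "E' n = (if n \<in> \<MM> then E n else {})" for n
  have "summable (\<lambda>n. prob (E' n))"
  proof (rule summable_comparison_test_ev)
    show "summable (\<lambda>n. C0 * M powr (- K) * real n powr (- 2))"
      by (intro summable_mult) (simp add: summable_real_powr_iff)
    show "\<forall>\<^sub>F n in sequentially. norm (prob (E' n)) \<le> C0 * M powr (- K) * real n powr (- 2)"
      using many_fragments[unfolded ev_iff]
    proof eventually_elim
      case (elim n)
      show ?case
      proof (cases "n \<in> \<MM>")
        case True
        have "real (card (\<R> n)) powr (- K) \<le> (M * real n powr \<kappa>) powr (- K)"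
          using elim True pos1 n1[OF True] K by (intro powr_mono2') auto
        also have "\<dots> = M powr (- K) * real n powr (- 2)"
          using pos1 by (simp add: powr_mult powr_powr K_def)
        finally have "C0 * real (card (\<R> n)) powr (- K) \<le> C0 * (M powr (- K) * real n powr (- 2))"
          using C0 by (rule mult_left_mono)
        then show ?thesis using PE[OF True] True by (simp add: E'_def mult.assoc)
      qed (use C0 in \<open>simp add: E'_def\<close>)
    qed
  qed
  then have BC: "AE \<omega> in \<Omega>. \<forall>\<^sub>F n in sequentially. \<omega> \<in> space \<Omega> - E' n"
    using E by (intro borel_cantelli_AE1) (auto simp: E'_def emeasure_eq_measure)

  \<comment> \<open>Deterministic error bound outside the exceptional events\<close>
  obtain C1 where C1: "C1 > 0" and quadratic:
    "\<And>x b W T m q :: real. T \<ge> 0 \<Longrightarrow> m \<ge> 0 \<Longrightarrow> q \<ge> 0 \<Longrightarrow> W\<^sup>2 \<le> \<theta> * T * (m + K) \<Longrightarrow>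
       x\<^sup>2 \<le> T * (q - m) + b\<^sup>2 + 2 * (x + b) * W \<Longrightarrow> x\<^sup>2 \<le> C1 * (T * q + b\<^sup>2 + T)"
    by (rule penalised_quadratic_bound[OF \<theta> K]) (rule that)
  define K2 where "K2 = (2 * C1 + (C1 + 1) * C\<^sup>2) * K1"
  define e where "e \<omega> n = (L2_norm (\<lambda>x. step_fun n (fhat n \<omega>) x - f x))\<^sup>2" for \<omega> n
  have key: "e \<omega> n \<le> K2 * (a n + b n)"
    if n: "n \<in> \<MM>" and \<omega>: "\<omega> \<in> space \<Omega>" "\<omega> \<notin> E n" and \<gamma>1: "\<gamma> n \<le> 1" and F1: "F n \<ge> 1"
      and \<gamma>: "\<gamma> n > \<beta> * D * ((\<kappa> + 1) / \<kappa>) * (ln (real (card (\<R> n))) / N n)" for n \<omega>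
  proof -
    define g where "g = discretise n f"
    define P where "P = Phat n \<omega>"
    define u where "u = fhat n \<omega>"
    define L where "L = ln (real (card (\<R> n)))"
    define x where "x = L2_set (\<lambda>s. u s - g s) (grid n)"
    define d where "d = L2_set (\<lambda>s. h n s - g s) (grid n)"
    define T where "T = \<gamma> n * N n"
    have T: "T \<ge> 0" using gamma_pos[OF n] N[OF n] by (simp add: T_def)
    have L: "L \<ge> 0" using R[OF n] by (simp add: L_def Suc_leI card_gt_0_iff)
    have seg: "P \<in> \<PP> n" "u \<in> partition_space G n P"
      and le: "penalised_loss n (\<gamma> n) (Y n \<omega>) (P, u) \<le> penalised_loss n (\<gamma> n) (Y n \<omega>) (Q n, h n)"
      using minimiser[OF n \<omega>(1)] Q[OF n] h[OF n]
      by (auto simp: is_arg_min_def segmentations_def P_def u_def not_less)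
    have basic: "x\<^sup>2 \<le> T * (real (card (Q n)) - real (card P)) + d\<^sup>2
        + 2 * (\<Sum>s\<in>grid n. (u s - h n s) * \<xi> n s \<omega>)"
      unfolding x_def d_def T_def N_def
      by (rule penalised_loss_basic_inequality[OF _ le])
         (use N[OF n] data[OF n \<omega>(1)] in \<open>auto simp: N_def g_def\<close>)
    obtain W where W: "W\<^sup>2 \<le> \<theta> * T * (real (card P) + K)"
      and cross: "(\<Sum>s\<in>grid n. (u s - h n s) * \<xi> n s \<omega>) \<le> (x + d) * W"
    proof (cases "D \<ge> 1")
      case True
      \<comment> \<open>The noise level carries no factor \<open>D\<close>; \<open>D \<ge> 1\<close>
        permits inserting it, so as to compare with the penalty.\<close>
      have "\<beta> * L / (1 - \<epsilon>) = \<beta> * L * (\<theta> * ((\<kappa> + 1) / \<kappa>))"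
        unfolding \<epsilon>\<theta> by simp
      also have "\<dots> = \<theta> * (\<beta> * 1 * ((\<kappa> + 1) / \<kappa>) * L)"
        by simp
      also have "\<dots> \<le> \<theta> * (\<beta> * D * ((\<kappa> + 1) / \<kappa>) * L)"
        using True pos1 pos2 L \<theta> by (intro mult_left_mono mult_right_mono) auto
      also have "\<dots> \<le> \<theta> * T"
      proof (intro mult_left_mono)
        have "\<beta> * D * ((\<kappa> + 1) / \<kappa>) * L / N n \<le> \<gamma> n"
          using \<gamma> by (simp add: L_def)
        then show "\<beta> * D * ((\<kappa> + 1) / \<kappa>) * L \<le> T"
          using N[OF n] by (simp only: T_def pos_divide_le_eq)
      qed (use \<theta> in simp)
      finally have LT: "\<beta> * L / (1 - \<epsilon>) \<le> \<theta> * T" .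
      have "y n P \<le> (real (card P) + K) * (\<theta> * T)"
        unfolding y_def L_def[symmetric] using LT K by (intro mult_left_mono) auto
      moreover have "y n P \<ge> 0"
        unfolding y_def L_def[symmetric] using L K pos2 \<epsilon> by auto
      ultimately have "(sqrt (y n P))\<^sup>2 \<le> \<theta> * T * (real (card P) + K)" by (simp add: mult_ac)
      moreover have "L2_set (\<lambda>s. u s - h n s) (grid n) \<le> x + d"
      proof -
        have "L2_set (\<lambda>s. u s - h n s) (grid n) = L2_set (\<lambda>s. (u s - g s) + (g s - h n s)) (grid n)"
          by simp
        also have "\<dots> \<le> x + L2_set (\<lambda>s. g s - h n s) (grid n)"
          unfolding x_def by (rule L2_set_triangle_ineq)
        also have "L2_set (\<lambda>s. g s - h n s) (grid n) = d"
          by (simp add: d_def L2_set_def power2_commute)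
        finally show ?thesis .
      qed
      then have "L2_set (\<lambda>s. u s - h n s) (grid n) * sqrt (y n P) \<le> (x + d) * sqrt (y n P)"
        using \<open>y n P \<ge> 0\<close> by (intro mult_right_mono) auto
      then have "(\<Sum>s\<in>grid n. (u s - h n s) * \<xi> n s \<omega>) \<le> (x + d) * sqrt (y n P)"
        using E_good[OF n \<omega> seg] by linarith
      ultimately show thesis by (rule that)
    next
      \<comment> \<open>For \<open>D < 1\<close> the lower bound on \<open>\<gamma>\<close> is useless, but all fragment spaces are trivial.\<close>
      case False
      then have D': "D' = 0" by (simp add: D'_def)
      have zero: "v = 0" if P: "P \<in> \<PP> n" and v: "v \<in> partition_space G n P" for P v
      proof -
        obtain B where "finite B" "card B \<le> D' * card P" "partition_space G n P \<subseteq> fun_space.span B"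
          using partition_space_frame[of P G n D'] finQ[OF n P] dim[OF n] by blast
        then show ?thesis using v D' by auto
      qed
      have "u = 0" "h n = 0" using zero seg h[OF n] Q[OF n] by blast+
      then show thesis using T \<theta> K by (intro that[of 0]) auto
    qed
    have "x\<^sup>2 \<le> C1 * (T * real (card (Q n)) + d\<^sup>2 + T)"
    proof (rule quadratic[OF T _ _ W])
      show "x\<^sup>2 \<le> T * (real (card (Q n)) - real (card P)) + d\<^sup>2 + 2 * (x + d) * W"
        using basic cross unfolding mult.assoc by linarith
    qed auto
    \<comment> \<open>The solitary \<open>T\<close> is absorbed because
      \<open>k n \<ge> 1\<close>.\<close>
    also have "\<dots> \<le> C1 * (2 * (T * real (k n)) + d\<^sup>2)"
    proof (intro mult_left_mono)
      have "T * real (card (Q n)) \<le> T * real (k n)" using Qk[OF n] T by (intro mult_left_mono) auto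
      moreover have "T * 1 \<le> T * real (k n)" using k[OF n] T by (intro mult_left_mono) auto
      ultimately show "T * real (card (Q n)) + d\<^sup>2 + T \<le> 2 * (T * real (k n)) + d\<^sup>2" by simp
    qed (use C1 in simp)
    finally have "x\<^sup>2 / N n \<le> C1 * (2 * (T * real (k n)) + d\<^sup>2) / N n"
      using N[OF n] by (intro divide_right_mono) auto
    also have "\<dots> = C1 * (2 * (\<gamma> n * real (k n)) + d\<^sup>2 / N n)"
      using N[OF n] by (simp add: T_def field_simps)
    finally have x: "x\<^sup>2 / N n \<le> C1 * (2 * (\<gamma> n * real (k n)) + d\<^sup>2 / N n)" .
    \<comment> \<open>The same \<open>B\<close> serves the estimator and the competitor, so it can
      be carried from one side to the other.\<close>
    obtain B where B: "B \<ge> 0" and dist: "\<And>z. (L2_norm (\<lambda>x. step_fun n z x - f x))\<^sup>2 =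
        (L2_set (\<lambda>s. z s - g s) (grid n))\<^sup>2 / N n + B"
      by (rule L2_dist_step_fun[OF n1[OF n] f, folded g_def N_def]) (rule that)
    have "L2_norm (\<lambda>x. step_fun n (h n) x - f x) \<ge> 0" by (simp add: L2_norm_def integral_nonneg_AE)
    then have "(L2_norm (\<lambda>x. step_fun n (h n) x - f x))\<^sup>2 \<le> (C * r n (k n))\<^sup>2"
      using h_err[OF n] by (intro power_mono) auto
    then have d: "d\<^sup>2 / N n + B \<le> C\<^sup>2 * (r n (k n))\<^sup>2"
      unfolding dist d_def by (simp add: power_mult_distrib)
    have "e \<omega> n = x\<^sup>2 / N n + B" by (simp add: e_def dist x_def u_def)
    also have "\<dots> \<le> 2 * C1 * (\<gamma> n * real (k n)) + C1 * (d\<^sup>2 / N n) + B"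
      using x by (simp add: algebra_simps)
    also have "\<dots> \<le> 2 * C1 * (\<gamma> n * real (k n)) + (C1 + 1) * (d\<^sup>2 / N n + B)"
      using C1 B N[OF n] by (simp add: algebra_simps)
    also have "\<dots> \<le> 2 * C1 * (\<gamma> n * real (k n)) + (C1 + 1) * (C\<^sup>2 * (r n (k n))\<^sup>2)"
      using d C1 by (intro add_left_mono mult_left_mono) auto
    also have "\<dots> \<le> (2 * C1 + (C1 + 1) * C\<^sup>2) * (\<gamma> n * real (k n)) + (2 * C1 + (C1 + 1) * C\<^sup>2) * (r n (k n))\<^sup>2"
      unfolding mult.assoc[symmetric] using C1 gamma_pos[OF n]
      by (intro add_mono mult_right_mono) auto
    also have "\<dots> = (2 * C1 + (C1 + 1) * C\<^sup>2) * (\<gamma> n * real (k n) + (r n (k n))\<^sup>2)"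
      by (simp add: distrib_left)
    also have "\<dots> \<le> (2 * C1 + (C1 + 1) * C\<^sup>2) * (K1 * (a n + b n))"
      using k_bound[OF n \<gamma>1 F1] C1 by (intro mult_left_mono) auto
    finally show ?thesis by (simp add: K2_def mult.assoc)
  qed

  \<comment> \<open>Passage to almost every outcome and splitting of the rate\<close>
  have \<gamma>_le: "\<forall>\<^sub>F n in sequentially. n \<in> \<MM> \<longrightarrow> \<gamma> n \<le> 1"
    using order_tendstoD(2)[OF gamma_lim, of 1] unfolding ev_iff by (auto elim!: eventually_mono)
  have F_ge: "\<forall>\<^sub>F n in sequentially. n \<in> \<MM> \<longrightarrow> F n \<ge> 1"
    using F_lim unfolding filterlim_at_top ev_iff by blast
  have K2: "K2 \<ge> 0" unfolding K2_def K1_def using C1 by simp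
  show ?thesis
    using BC
  proof (rule AE_mp, intro AE_I2 impI)
    fix \<omega> assume \<omega>: "\<omega> \<in> space \<Omega>" and good: "\<forall>\<^sub>F n in sequentially. \<omega> \<in> space \<Omega> - E' n"
    have "\<forall>\<^sub>F n in sequentially. n \<in> \<MM> \<longrightarrow> e \<omega> n \<le> K2 * (a n + b n)"
      using good \<gamma>_le F_ge gamma_large[unfolded ev_iff]
    proof eventually_elim
      case (elim n)
      then show ?case using key[of n \<omega>] by (auto simp: E'_def N_def)
    qed
    then have "\<exists>A\<in>O[?\<F>](a). \<exists>B\<in>O[?\<F>](b). \<forall>n. e \<omega> n = A n + B n"
      unfolding ev_iff[symmetric] by (rule bigo_sum_split) (auto simp: e_def a_def b_def K2)
    then show "\<exists>A\<in>O[?\<F>](\<lambda>n. \<gamma> n powr (2 * \<alpha> / (2 * \<alpha> + 1))).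
        \<exists>B\<in>O[?\<F>](\<lambda>n. F n powr (- (2 * \<alpha> / (\<alpha> + \<rho>)))).
          \<forall>n\<in>\<MM>. (L2_norm (\<lambda>x. step_fun n (fhat n \<omega>) x - f x))\<^sup>2 = A n + B n"
      unfolding a_def[abs_def] b_def[abs_def] e_def by blast
  qed
qed

end
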